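(* Let $\mathbb{M}$ be a lattice ordered additive monoid and $\varphi:\mathbb{M}\to\mathbb{M}$ an arbitrary function. For all $n\ge 1$ and $2\le k\le n+1$ the formulas defining $\hat T_{n,k}$ and $\check T_{n,k}$ (see context) give well-defined functions $\hat T_{n,k}:\mathcal{O}_n\to\mathcal{O}_{n+2}$ and $\check T_{n,k}:\mathcal{O}_{n+2}\to\mathcal{O}_n$. Moreover, whenever all indices occurring are in the admissible ranges, these functions satisfy (1) $\check{T}_{n,k+1}\circ\hat{T}_{n,k}=\mathrm{id}$ and $\check{T}_{n,k-1}\circ\hat{T}_{n,k}=\mathrm{id}$; (2) $\hat{T}_{n+2,l}\circ\hat{T}_{n,k}=\hat{T}_{n+2,k}\circ\hat{T}_{n,l-2}$ for $l\geq k+2$; (3) $\check{T}_{n-2,l-2}\circ\check{T}_{n,k}=\check{T}_{n-2,k}\circ\check{T}_{n,l}$ for $l\geq k+2$; (4) $\hat{T}_{n-2,l-2}\circ\check{T}_{n-2,k}=\check{T}_{n,k}\circ\hat{T}_{n,l}$ for $l\geq k+2$; (5) $\check{T}_{n,l}\circ\hat{T}_{n,k}=\hat{T}_{n-2,k}\circ\check{T}_{n-2,l-2}$ for $l\geq k+2$. Consequently, sending the object of $\mathbf{PT}$ with $n$ points to $\mathcal{O}_{n+1}$, $\hat t_{n,k}$ to $\hat T_{n,k}$ and $\check t_{n,k}$ to $\check T_{n,k}$ defines a functor $\mathbf{PT}\to\mathbf{PI}_{\mathbb{M}}$.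
   Context: Lattice ordered additive monoid: a set $\mathbb{M}$ with binary operations $\oplus,\vee,\wedge$ and an element $\emptyset$ such that $(\mathbb{M},\oplus,\emptyset)$ is a commutative monoid with identity $\emptyset$; $(\mathbb{M},\vee,\wedge)$ is a distributive lattice; $\emptyset\vee a=a$, $\emptyset\wedge a=\emptyset$; $a\oplus(b\vee c)=(a\oplus b)\vee(a\oplus c)$ and $a\oplus(b\wedge c)=(a\oplus b)\wedge(a\oplus c)$. The order is $a\le b\iff a\vee b=b$. Boolean matrices: matrices with entries in $\{0,1\}$, where $1+1=1$, $\neg 0=1$, $\neg 1=0$; sum, product and transpose $A^t$ are defined as usual with this arithmetic, and $\le$ is entrywise. $\{0,1\}$ acts on $\mathbb{M}$ by $1*m=m$, $0*m=\emptyset$; a Boolean $m\times n$ matrix acts on an array $(a_j)\in\mathbb{M}^n$ by $[v_{i,j}]*(a_j)=(\bigvee_{j}v_{i,j}*a_j)_{i=1,\dots,m}$; for a one-column Boolean matrix $e=[\epsilon_i]$ and $x\in\mathbb{M}$, $e*x=(\epsilon_i*x)_i$. On arrays $\oplus,\vee$ are coordinatewise. $B_{n,k}=[b_{i,j}]$ is the $(n+2)\times n$ Boolean matrix with $b_{i,j}=1$ iff $i=j<k$ or $i=j+2>k$. $D_{n,k}$ is the $n\times n$ Boolean matrix whose only entry equal to $1$ is at $(k,k)$. $e_{n,k}$ is the one-column Boolean matrix of length $n$ whose only entry equal to $1$ is the $k$-th. $\mathcal{O}_n$ ($n\ge1$) is the set of pairs $(R,\overrightarrow{v})$ where $\overrightarrow{v}\in\mathbb{M}^n$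 and $R=[r_{i,j}]$ is an $n\times n$ Boolean matrix with: (E1) $R\ge I$; (E2) $R^t=R$; (E3) $R^2=R$; (T1) if $r_{i,j}=1$ then $|i-j|$ is even; (T2) for $\alpha\le\beta\le\gamma\le\delta$, $r_{\alpha,\gamma}r_{\beta,\delta}\le r_{\alpha,\beta}r_{\beta,\gamma}r_{\gamma,\delta}$; (T3) for $\alpha<\beta$, if $r_{\alpha,\beta}=1$ then $r_{\alpha+1,\beta-1}=1$ or there is $\gamma$ with $\alpha<\gamma<\beta$ and $r_{\alpha,\gamma}=1$; and (EC) $R*\overrightarrow{v}=\overrightarrow{v}$. $\mathbf{PI}_{\mathbb{M}}$ is the category with objects $\mathcal{O}_1,\mathcal{O}_2,\dots$ and all set functions as morphisms. For $n\ge1$, $2\le k\le n+1$ (the admissible ranges): $\hat T_{n,k}(R,\overrightarrow v)=(B_{n,k}RB_{n,k}^t+D_{n+2,k},\;B_{n,k}*\overrightarrow v)$ for $(R,\overrightarrow v)\in\mathcal{O}_n$; $\check T_{n,k}(R,\overrightarrow v)=(R',\;R'*[(B_{n,k}^t*\overrightarrow v)\oplus(e_{n,k-1}*x_k)])$ for $(R,\overrightarrow v)\in\mathcal{O}_{n+2}$, where $R'=(B_{n,k}^tRB_{n,k})^2$ and $x_k=\varphi(v_k)$ if $r_{k-1,k+1}=1$, $x_k=v_{k-1}\wedge v_{k+1}$ if $r_{k-1,k+1}=0$. $\mathbf{PT}$, the category of non-singular planar tangles: objects are finite sets of points of the real line up to isotopy (i.e. $\emptyset,\{1\},\{1,2\},\dots$);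 morphisms $O_1\to O_2$ are piecewise regular compact 1-manifolds embedded in $\mathbb{R}\times[0,1]$ with boundary $O_1\times\{1\}\cup O_2\times\{0\}$, up to planar isotopy; $t_2\circ t_1$ is obtained by stacking $t_1$ above $t_2$ and rescaling. It has a presentation with generators $\hat t_{n,k}$ (from $n-1$ points to $n+1$ points, creating an arc joining the bottom points $k-1$ and $k$, other points joined in order) and $\check t_{n,k}$ (from $n+1$ points to $n-1$ points, with an arc joining the top points $k-1$ and $k$), $n\ge1$, $2\le k\le n+1$, and relations (1)–(5) of the claim with $\hat t,\check t$ in place of $\hat T,\check T$. *)

theory Defs
  imports "HOL-Analysis.Analysis"
begin

section \<open>Lattice ordered additive monoids\<close>

text \<open>The monoid operation is \<open>+\<close> with identity \<open>0\<close> (the paper's empty-set symbol), and the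
  lattice operations are \<open>sup\<close> and \<open>inf\<close>. In a lattice \<open>a \<le> b \<longleftrightarrow> sup a b = b\<close>.\<close>

class lattice_ordered_additive_monoid = comm_monoid_add + distrib_lattice +
  assumes sup_zero: "sup 0 a = a"
    and inf_zero: "inf 0 a = 0"
    and add_sup_distrib: "a + sup b c = sup (a + b) (a + c)"
    and add_inf_distrib: "a + inf b c = inf (a + b) (a + c)"


section \<open>Boolean matrices\<close>

text \<open>The entries \<open>0\<close>, \<open>1\<close> are \<open>False\<close>, \<open>True\<close>, so that \<open>1 + 1 = 1\<close>. Indices start at \<open>1\<close>. To make
  equality of functions the equality of matrices and arrays, an \<open>m \<times> n\<close> matrix is \<open>False\<close> outside
  \<open>{1..m} \<times> {1..n}\<close> and an array of length \<open>n\<close> is \<open>0\<close> outside \<open>{1..n}\<close>.\<close>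

type_synonym bmat = "nat \<Rightarrow> nat \<Rightarrow> bool"

definition is_bmat :: "nat \<Rightarrow> nat \<Rightarrow> bmat \<Rightarrow> bool" where
  "is_bmat m n A \<longleftrightarrow> (\<forall>i j. A i j \<longrightarrow> i \<in> {1..m} \<and> j \<in> {1..n})"

definition is_array :: "nat \<Rightarrow> (nat \<Rightarrow> 'm::zero) \<Rightarrow> bool" where
  "is_array n v \<longleftrightarrow> (\<forall>i. i \<notin> {1..n} \<longrightarrow> v i = 0)"

definition bm_le :: "bmat \<Rightarrow> bmat \<Rightarrow> bool" where
  "bm_le A B \<longleftrightarrow> (\<forall>i j. A i j \<longrightarrow> B i j)"

definition bm_one :: "nat \<Rightarrow> bmat" where
  "bm_one n i j \<longleftrightarrow> i = j \<and> i \<in> {1..n}"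

definition bm_add :: "bmat \<Rightarrow> bmat \<Rightarrow> bmat" where
  "bm_add A B i j \<longleftrightarrow> A i j \<or> B i j"

text \<open>The first argument is the common inner dimension.\<close>

definition bm_mult :: "nat \<Rightarrow> bmat \<Rightarrow> bmat \<Rightarrow> bmat" where
  "bm_mult p A B i j \<longleftrightarrow> (\<exists>l\<in>{1..p}. A i l \<and> B l j)"

definition bm_transpose :: "bmat \<Rightarrow> bmat" where
  "bm_transpose A i j \<longleftrightarrow> A j i"

definition scal :: "bool \<Rightarrow> 'm \<Rightarrow> 'm::zero" where
  "scal b x = (if b then x else 0)"

text \<open>\<open>bm_act n V a\<close> is \<open>V * a\<close> for a matrix with \<open>n \<ge> 1\<close> columns.\<close>

definition bm_act :: "nat \<Rightarrow> bmat \<Rightarrow> (nat \<Rightarrow> 'm) \<Rightarrow> (nat \<Rightarrow> 'm::lattice_ordered_additive_monoid)" where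
  "bm_act n V a i = \<Squnion>\<^sub>f\<^sub>i\<^sub>n ((\<lambda>j. scal (V i j) (a j)) ` {1..n})"

definition col_act :: "(nat \<Rightarrow> bool) \<Rightarrow> 'm \<Rightarrow> (nat \<Rightarrow> 'm::zero)" where
  "col_act e x i = scal (e i) x"

definition array_add :: "(nat \<Rightarrow> 'm) \<Rightarrow> (nat \<Rightarrow> 'm) \<Rightarrow> (nat \<Rightarrow> 'm::plus)" where
  "array_add a b i = a i + b i"

definition matB :: "nat \<Rightarrow> nat \<Rightarrow> bmat" where
  "matB n k i j \<longleftrightarrow> i \<in> {1..n+2} \<and> j \<in> {1..n} \<and> ((i = j \<and> j < k) \<or> (i = j + 2 \<and> j + 2 > k))"

definition matD :: "nat \<Rightarrow> nat \<Rightarrow> bmat" where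
  "matD n k i j \<longleftrightarrow> i = k \<and> j = k \<and> k \<in> {1..n}"

definition col_e :: "nat \<Rightarrow> nat \<Rightarrow> nat \<Rightarrow> bool" where
  "col_e n k i \<longleftrightarrow> i = k \<and> k \<in> {1..n}"


section \<open>The sets of planar relations with values\<close>

type_synonym 'm pobj = "bmat \<times> (nat \<Rightarrow> 'm)"

definition T1_cond :: "nat \<Rightarrow> bmat \<Rightarrow> bool" where
  "T1_cond n R \<longleftrightarrow> (\<forall>i\<in>{1..n}. \<forall>j\<in>{1..n}. R i j \<longrightarrow> even \<bar>int i - int j\<bar>)"

definition T2_cond :: "nat \<Rightarrow> bmat \<Rightarrow> bool" where
  "T2_cond n R \<longleftrightarrow> (\<forall>\<alpha>\<in>{1..n}. \<forall>\<beta>\<in>{1..n}. \<forall>\<gamma>\<in>{1..n}. \<forall>\<delta>\<in>{1..n}.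
     \<alpha> \<le> \<beta> \<and> \<beta> \<le> \<gamma> \<and> \<gamma> \<le> \<delta> \<longrightarrow> R \<alpha> \<gamma> \<and> R \<beta> \<delta> \<longrightarrow> R \<alpha> \<beta> \<and> R \<beta> \<gamma> \<and> R \<gamma> \<delta>)"

definition T3_cond :: "nat \<Rightarrow> bmat \<Rightarrow> bool" where
  "T3_cond n R \<longleftrightarrow> (\<forall>\<alpha>\<in>{1..n}. \<forall>\<beta>\<in>{1..n}. \<alpha> < \<beta> \<longrightarrow> R \<alpha> \<beta> \<longrightarrow>
     R (\<alpha> + 1) (\<beta> - 1) \<or> (\<exists>\<gamma>. \<alpha> < \<gamma> \<and> \<gamma> < \<beta> \<and> R \<alpha> \<gamma>))"

definition obj_set :: "nat \<Rightarrow> 'm::lattice_ordered_additive_monoid pobj set" where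
  "obj_set n = {(R, v). is_bmat n n R \<and> is_array n v \<and>
     bm_le (bm_one n) R \<and> bm_transpose R = R \<and> bm_mult n R R = R \<and>
     T1_cond n R \<and> T2_cond n R \<and> T3_cond n R \<and> bm_act n R v = v}"

definition admissible :: "nat \<Rightarrow> nat \<Rightarrow> bool" where
  "admissible n k \<longleftrightarrow> 1 \<le> n \<and> 2 \<le> k \<and> k \<le> n + 1"

definition T_hat :: "nat \<Rightarrow> nat \<Rightarrow> 'm pobj \<Rightarrow> 'm::lattice_ordered_additive_monoid pobj" where
  "T_hat n k = (\<lambda>(R, v).
     (bm_add (bm_mult n (bm_mult n (matB n k) R) (bm_transpose (matB n k))) (matD (n + 2) k),
      bm_act n (matB n k) v))"

definition T_check ::
    "('m \<Rightarrow> 'm) \<Rightarrow> nat \<Rightarrow> nat \<Rightarrow> 'm pobj \<Rightarrow> 'm::lattice_ordered_additive_monoid pobj" where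
  "T_check \<phi> n k = (\<lambda>(R, v).
     let P = bm_mult (n + 2) (bm_mult (n + 2) (bm_transpose (matB n k)) R) (matB n k);
         R' = bm_mult n P P;
         x = (if R (k - 1) (k + 1) then \<phi> (v k) else inf (v (k - 1)) (v (k + 1)))
     in (R', bm_act n R' (array_add (bm_act (n + 2) (bm_transpose (matB n k)) v)
                                    (col_act (col_e n (k - 1)) x))))"


section \<open>Categories and functors\<close>

record ('o, 'a) cat =
  Obj :: "'o set"
  Hom :: "'o \<Rightarrow> 'o \<Rightarrow> 'a set"
  Idn :: "'o \<Rightarrow> 'a"
  Cmp :: "'o \<Rightarrow> 'o \<Rightarrow> 'o \<Rightarrow> 'a \<Rightarrow> 'a \<Rightarrow> 'a"

text \<open>\<open>Cmp C a b c g f\<close> is \<open>g \<circ> f\<close> for \<open>f : a \<rightarrow> b\<close> and \<open>g : b \<rightarrow> c\<close>. Hom-sets need not be disjoint;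
  hence source and target are arguments of composition and of the morphism part of functors.\<close>

definition category :: "('o, 'a) cat \<Rightarrow> bool" where
  "category C \<longleftrightarrow>
    (\<forall>a\<in>Obj C. Idn C a \<in> Hom C a a) \<and>
    (\<forall>a\<in>Obj C. \<forall>b\<in>Obj C. \<forall>c\<in>Obj C. \<forall>f\<in>Hom C a b. \<forall>g\<in>Hom C b c. Cmp C a b c g f \<in> Hom C a c) \<and>
    (\<forall>a\<in>Obj C. \<forall>b\<in>Obj C. \<forall>f\<in>Hom C a b.
       Cmp C a a b f (Idn C a) = f \<and> Cmp C a b b (Idn C b) f = f) \<and>
    (\<forall>a\<in>Obj C. \<forall>b\<in>Obj C. \<forall>c\<in>Obj C. \<forall>d\<in>Obj C.
       \<forall>f\<in>Hom C a b. \<forall>g\<in>Hom C b c. \<forall>h\<in>Hom C c d.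
       Cmp C a b d (Cmp C b c d h g) f = Cmp C a c d h (Cmp C a b c g f))"

definition is_functor ::
    "('o, 'a) cat \<Rightarrow> ('p, 'b) cat \<Rightarrow> ('o \<Rightarrow> 'p) \<Rightarrow> ('o \<Rightarrow> 'o \<Rightarrow> 'a \<Rightarrow> 'b) \<Rightarrow> bool" where
  "is_functor C D Fo Fm \<longleftrightarrow> category C \<and> category D \<and>
    (\<forall>a\<in>Obj C. Fo a \<in> Obj D) \<and>
    (\<forall>a\<in>Obj C. \<forall>b\<in>Obj C. \<forall>f\<in>Hom C a b. Fm a b f \<in> Hom D (Fo a) (Fo b)) \<and>
    (\<forall>a\<in>Obj C. Fm a a (Idn C a) = Idn D (Fo a)) \<and>
    (\<forall>a\<in>Obj C. \<forall>b\<in>Obj C. \<forall>c\<in>Obj C. \<forall>f\<in>Hom C a b. \<forall>g\<in>Hom C b c.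
       Fm a c (Cmp C a b c g f) = Cmp D (Fo a) (Fo b) (Fo c) (Fm b c g) (Fm a b f))"

definition PI_cat :: "('m::lattice_ordered_additive_monoid pobj set, 'm pobj \<Rightarrow> 'm pobj) cat" where
  "PI_cat = \<lparr> Obj = {obj_set n |n. 1 \<le> n},
              Hom = (\<lambda>A B. A \<rightarrow>\<^sub>E B),
              Idn = (\<lambda>A. \<lambda>x\<in>A. x),
              Cmp = (\<lambda>A B C g f. compose A g f) \<rparr>"


section \<open>The category of non-singular planar tangles\<close>

definition regular_on :: "(real \<Rightarrow> real \<times> real) \<Rightarrow> real \<Rightarrow> real \<Rightarrow> bool" where
  "regular_on g a b \<longleftrightarrow> (\<exists>g'. continuous_on {a..b} g' \<and>
     (\<forall>t\<in>{a..b}. g' t \<noteq> 0 \<and> (g has_vector_derivative g' t) (at t within {a..b})))"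

definition piecewise_regular :: "(real \<Rightarrow> real \<times> real) \<Rightarrow> bool" where
  "piecewise_regular g \<longleftrightarrow> (\<exists>N t. 0 < N \<and> t 0 = 0 \<and> t N = 1 \<and>
     (\<forall>i<N. t i < t (Suc i) \<and> regular_on g (t i) (t (Suc i))))"

definition strip :: "(real \<times> real) set" where
  "strip = UNIV \<times> {0..1}"

text \<open>The finite set with \<open>n\<close> points is \<open>{1, \<dots>, n}\<close>. The source lies on the top line of the strip.\<close>

definition tangle_boundary :: "nat \<Rightarrow> nat \<Rightarrow> (real \<times> real) set" where
  "tangle_boundary m n = (real ` {1..m}) \<times> {1} \<union> (real ` {1..n}) \<times> {0}"

text \<open>A compact 1-manifold is a finite disjoint union of arcs and simple closed curves. Its boundary
  consists of the endpoints of the arcs, and only the boundary lies on the two boundary lines of the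
  strip (otherwise stacking would not give manifolds).\<close>

definition is_tangle :: "nat \<Rightarrow> nat \<Rightarrow> (real \<times> real) set \<Rightarrow> bool" where
  "is_tangle m n T \<longleftrightarrow> (\<exists>G. finite G \<and>
     (\<forall>g\<in>G. piecewise_regular g \<and> (arc g \<or> (simple_path g \<and> pathfinish g = pathstart g))) \<and>
     pairwise (\<lambda>g h. path_image g \<inter> path_image h = {}) G \<and>
     T = (\<Union>g\<in>G. path_image g) \<and>
     T \<subseteq> strip \<and>
     (\<Union>g\<in>{g\<in>G. arc g}. {pathstart g, pathfinish g}) = tangle_boundary m n \<and>
     T \<inter> UNIV \<times> {0, 1} = tangle_boundary m n)"

text \<open>Planar isotopy: ambient isotopy of the strip, fixing its two boundary lines.\<close>

definition planar_isotopic :: "(real \<times> real) set \<Rightarrow> (real \<times> real) set \<Rightarrow> bool" where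
  "planar_isotopic S T \<longleftrightarrow> (\<exists>H :: real \<Rightarrow> real \<times> real \<Rightarrow> real \<times> real.
     continuous_on ({0..1} \<times> strip) (\<lambda>(s, p). H s p) \<and>
     (\<forall>s\<in>{0..1}. \<exists>h. homeomorphism strip strip (H s) h) \<and>
     (\<forall>p\<in>strip. H 0 p = p) \<and>
     (\<forall>s\<in>{0..1}. \<forall>p\<in>UNIV \<times> {0, 1}. H s p = p) \<and>
     H 1 ` S = T)"

definition isotopy_rel :: "nat \<Rightarrow> nat \<Rightarrow> ((real \<times> real) set \<times> (real \<times> real) set) set" where
  "isotopy_rel m n = {(S, T). is_tangle m n S \<and> is_tangle m n T \<and> planar_isotopic S T}"

definition stack :: "(real \<times> real) set \<Rightarrow> (real \<times> real) set \<Rightarrow> (real \<times> real) set" where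
  "stack U L = (\<lambda>(x, y). (x, (1 + y) / 2)) ` U \<union> (\<lambda>(x, y). (x, y / 2)) ` L"

definition PT_cat :: "(nat, (real \<times> real) set set) cat" where
  "PT_cat = \<lparr> Obj = UNIV,
              Hom = (\<lambda>m n. {T. is_tangle m n T} // isotopy_rel m n),
              Idn = (\<lambda>n. isotopy_rel n n ``
                       {\<Union>i\<in>{1..n}. closed_segment (real i, 0) (real i, 1)}),
              Cmp = (\<lambda>m n p g f. \<Union>U\<in>f. \<Union>L\<in>g. isotopy_rel m p `` {stack U L}) \<rparr>"

text \<open>\<open>hat_picture n k\<close> has \<open>n - 1\<close> points at the top and \<open>n + 1\<close> at the bottom.\<close>

definition hat_picture :: "nat \<Rightarrow> nat \<Rightarrow> (real \<times> real) set" where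
  "hat_picture n k =
     (\<Union>i\<in>{i. 1 \<le> i \<and> i < k - 1}. closed_segment (real i, 1) (real i, 0)) \<union>
     (\<Union>i\<in>{i. k - 1 \<le> i \<and> i \<le> n - 1}. closed_segment (real i, 1) (real i + 2, 0)) \<union>
     (closed_segment (real k - 1, 0) (real k - 1 / 2, 1 / 2) \<union>
      closed_segment (real k - 1 / 2, 1 / 2) (real k, 0))"

definition check_picture :: "nat \<Rightarrow> nat \<Rightarrow> (real \<times> real) set" where
  "check_picture n k = (\<lambda>(x, y). (x, 1 - y)) ` hat_picture n k"

definition t_hat :: "nat \<Rightarrow> nat \<Rightarrow> (real \<times> real) set set" where
  "t_hat n k = isotopy_rel (n - 1) (n + 1) `` {hat_picture n k}"

definition t_check :: "nat \<Rightarrow> nat \<Rightarrow> (real \<times> real) set set" where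
  "t_check n k = isotopy_rel (n + 1) (n - 1) `` {check_picture n k}"


section \<open>The presentation by generators and relations\<close>

datatype tangle_gen = Hat nat nat | Check nat nat

fun gen_ok :: "tangle_gen \<Rightarrow> bool" where
  "gen_ok (Hat n k) = admissible n k"
| "gen_ok (Check n k) = admissible n k"

fun gen_src :: "tangle_gen \<Rightarrow> nat" where
  "gen_src (Hat n k) = n - 1"
| "gen_src (Check n k) = n + 1"

fun gen_tgt :: "tangle_gen \<Rightarrow> nat" where
  "gen_tgt (Hat n k) = n + 1"
| "gen_tgt (Check n k) = n - 1"

text \<open>A word stands for the composite of its letters, the last letter being applied first.\<close>

inductive is_word :: "nat \<Rightarrow> nat \<Rightarrow> tangle_gen list \<Rightarrow> bool" where
  "is_word m m []"
| "is_word m n w \<Longrightarrow> gen_ok x \<Longrightarrow> gen_src x = n \<Longrightarrow> is_word m (gen_tgt x) (x # w)"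

inductive tangle_relation :: "tangle_gen list \<Rightarrow> tangle_gen list \<Rightarrow> bool" where
  rel1a: "tangle_relation [Check n (k + 1), Hat n k] []"
| rel1b: "tangle_relation [Check n (k - 1), Hat n k] []"
| rel2: "l \<ge> k + 2 \<Longrightarrow> tangle_relation [Hat (n + 2) l, Hat n k] [Hat (n + 2) k, Hat n (l - 2)]"
| rel3: "l \<ge> k + 2 \<Longrightarrow>
    tangle_relation [Check (n - 2) (l - 2), Check n k] [Check (n - 2) k, Check n l]"
| rel4: "l \<ge> k + 2 \<Longrightarrow>
    tangle_relation [Hat (n - 2) (l - 2), Check (n - 2) k] [Check n k, Hat n l]"
| rel5: "l \<ge> k + 2 \<Longrightarrow>
    tangle_relation [Check n l, Hat n k] [Hat (n - 2) k, Check (n - 2) (l - 2)]"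

text \<open>The congruence generated by the relations. Requiring both sides of a relation to be words from
  \<open>m\<close> to \<open>n\<close> enforces that all indices are admissible.\<close>

inductive word_cong :: "nat \<Rightarrow> nat \<Rightarrow> tangle_gen list \<Rightarrow> tangle_gen list \<Rightarrow> bool" where
  wc_rel: "tangle_relation u w \<Longrightarrow> is_word m n u \<Longrightarrow> is_word m n w \<Longrightarrow> word_cong m n u w"
| wc_refl: "is_word m n w \<Longrightarrow> word_cong m n w w"
| wc_sym: "word_cong m n u w \<Longrightarrow> word_cong m n w u"
| wc_trans: "word_cong m n u w \<Longrightarrow> word_cong m n w x \<Longrightarrow> word_cong m n u x"
| wc_comp: "word_cong n p u u' \<Longrightarrow> word_cong m n w w' \<Longrightarrow> word_cong m p (u @ w) (u' @ w')"

definition word_rel :: "nat \<Rightarrow> nat \<Rightarrow> (tangle_gen list \<times> tangle_gen list) set" where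
  "word_rel m n = {(u, w). word_cong m n u w}"

definition presented_cat :: "(nat, tangle_gen list set) cat" where
  "presented_cat = \<lparr> Obj = UNIV,
                     Hom = (\<lambda>m n. {w. is_word m n w} // word_rel m n),
                     Idn = (\<lambda>n. word_rel n n `` {[]}),
                     Cmp = (\<lambda>m n p g f. \<Union>w\<in>f. \<Union>u\<in>g. word_rel m p `` {u @ w}) \<rparr>"

definition p_hat :: "nat \<Rightarrow> nat \<Rightarrow> tangle_gen list set" where
  "p_hat n k = word_rel (n - 1) (n + 1) `` {[Hat n k]}"

definition p_check :: "nat \<Rightarrow> nat \<Rightarrow> tangle_gen list set" where
  "p_check n k = word_rel (n + 1) (n - 1) `` {[Check n k]}"

text \<open>A category with objects \<open>0, 1, 2, \<dots>\<close> is presented by the given morphisms and the relations above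
  if it is isomorphic to the presented category by an isomorphism fixing objects and generators.\<close>

definition has_tangle_presentation ::
    "(nat, 'a) cat \<Rightarrow> (nat \<Rightarrow> nat \<Rightarrow> 'a) \<Rightarrow> (nat \<Rightarrow> nat \<Rightarrow> 'a) \<Rightarrow> bool" where
  "has_tangle_presentation C h c \<longleftrightarrow> Obj C = UNIV \<and> (\<exists>J. is_functor presented_cat C id J \<and>
     (\<forall>m n. bij_betw (J m n) (Hom presented_cat m n) (Hom C m n)) \<and>
     (\<forall>n k. admissible n k \<longrightarrow>
        J (n - 1) (n + 1) (p_hat n k) = h n k \<and> J (n + 1) (n - 1) (p_check n k) = c n k))"

definition extends_generators ::
    "('m \<Rightarrow> 'm) \<Rightarrow> (nat, 'a) cat \<Rightarrow> (nat \<Rightarrow> nat \<Rightarrow> 'a) \<Rightarrow> (nat \<Rightarrow> nat \<Rightarrow> 'a) \<Rightarrow>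
     (nat \<Rightarrow> nat \<Rightarrow> 'a \<Rightarrow> 'm pobj \<Rightarrow> 'm::lattice_ordered_additive_monoid pobj) \<Rightarrow> bool" where
  "extends_generators \<phi> C h c F \<longleftrightarrow>
     is_functor C PI_cat (\<lambda>n. obj_set (n + 1)) F \<and>
     (\<forall>n k. admissible n k \<longrightarrow>
        F (n - 1) (n + 1) (h n k) = restrict (T_hat n k) (obj_set n) \<and>
        F (n + 1) (n - 1) (c n k) = restrict (T_check \<phi> n k) (obj_set (n + 2)))"

definition defines_functor ::
    "('m::lattice_ordered_additive_monoid \<Rightarrow> 'm) \<Rightarrow> (nat, 'a) cat \<Rightarrow>
     (nat \<Rightarrow> nat \<Rightarrow> 'a) \<Rightarrow> (nat \<Rightarrow> nat \<Rightarrow> 'a) \<Rightarrow> bool" where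
  "defines_functor \<phi> C h c \<longleftrightarrow>
     (\<exists>F. extends_generators \<phi> C h c F) \<and>
     (\<forall>F F'. extends_generators \<phi> C h c F \<and> extends_generators \<phi> C h c F' \<longrightarrow>
        (\<forall>m\<in>Obj C. \<forall>n\<in>Obj C. \<forall>t\<in>Hom C m n. F m n t = F' m n t))"

end

theory Submission
  imports Defs
begin

text \<open>Think of \<open>1, \<dots>, n\<close> as the regions into which the points of a tangle cut the real line, of
  \<open>R\<close> as the relation of being connected above that line, and of \<open>v\<close> as a value carried by each
  connected component. An object is then a noncrossing, parity preserving partition with a value on
  each block, and \<open>T3_cond\<close> says that the regions just inside two consecutive members of a block
  lie in one block (\<open>planar_obj\<close>, \<open>obj_set_iff\<close>).

  Both operators are described by one map: \<open>glue k\<close> forgets region \<open>k\<close> and identifies the regions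
  \<open>k - 1\<close> and \<open>k + 1\<close>. Creating an arc pulls relation and values back along \<open>glue k\<close> and lets
  region \<open>k\<close> be a new block of value \<open>0\<close> (\<open>T_hat_simps\<close>). Closing an arc pushes forward: the blocks
  of \<open>k - 1\<close> and \<open>k + 1\<close> are united, and the value of the union is the sum of the two old values, or
  \<open>v (k - 1) + \<phi> (v k)\<close> if they were one block already, in which case \<open>k\<close> was a component of its own
  that is now enclosed (\<open>T_check_simps\<close>). The formula in the definition, with a supremum and an
  infimum, gives this sum because \<open>sup a b + inf a b = a + b\<close>.

  With these descriptions the relations follow from \<open>glue\<close> identities
  (\<open>glue (l - 2) \<circ> glue k = glue k \<circ> glue l\<close>) evaluated on representatives. Two points
  need geometry. First, \<open>T3_cond\<close> survives closing an arc (\<open>merge_nested\<close>): consecutive members of a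
  united block may come from different old blocks, one of them enclosing region \<open>k\<close>, and then the two
  regions below them are both connected to \<open>k\<close>. Second, closing two arcs in either order
  yields the same value (\<open>merge_val_commute\<close>): if no arc alone encloses anything but both together
  do, then the enclosed component contains \<open>k\<close> as well as \<open>l\<close> by \<open>T3_cond\<close>, so \<open>\<phi>\<close> is applied to the same
  value whichever arc is closed last.

  For the functor, a word of generators acts by composition, the relations make this action
  constant on congruence classes, and induction on words shows that its values on generators
  determine it. Everything transports along the isomorphism that a presentation provides.\<close>

section \<open>Lattice ordered monoids and the action of Boolean matrices\<close>

lemma loam_zero_le: "(0::'m::lattice_ordered_additive_monoid) \<le> a"
  using inf_zero[of a] by (metis inf.cobounded2)

lemma loam_add_left_mono:
  "(a::'m::lattice_ordered_additive_monoid) \<le> b \<Longrightarrow> c + a \<le> c + b"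
  by (metis add_sup_distrib le_iff_sup)

lemma loam_sup_add_inf:
  fixes a b :: "'m::lattice_ordered_additive_monoid"
  shows "sup a b + inf a b = a + b"
proof (rule antisym)
  have "sup a b + inf a b = inf a b + sup a b" by (simp add: add.commute)
  also have "\<dots> = sup (inf a b + a) (inf a b + b)" by (simp add: add_sup_distrib)
  also have "\<dots> \<le> a + b"
    by (metis add.commute loam_add_left_mono inf.cobounded1 inf.cobounded2 le_sup_iff)
  finally show "sup a b + inf a b \<le> a + b" .
  have "a + b \<le> inf (sup a b + a) (sup a b + b)"
    by (metis add.commute loam_add_left_mono le_inf_iff sup.cobounded1 sup.cobounded2)
  then show "a + b \<le> sup a b + inf a b" by (simp add: add_inf_distrib)
qed

lemma bm_act_eqI:
  assumes "j \<in> {1..n}" "V i j" "a j = c" "\<And>j. j \<in> {1..n} \<Longrightarrow> V i j \<Longrightarrow> a j \<le> c"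
  shows "bm_act n V a i = (c::'m::lattice_ordered_additive_monoid)"
proof (rule antisym)
  have ne: "(\<lambda>j. scal (V i j) (a j)) ` {1..n} \<noteq> {}" using assms(1) by auto
  show "bm_act n V a i \<le> c"
    unfolding bm_act_def using assms(4) loam_zero_le
    by (intro Sup_fin.boundedI ne) (auto simp: scal_def)
  have "c \<in> (\<lambda>j. scal (V i j) (a j)) ` {1..n}" using assms by (force simp: scal_def)
  then show "c \<le> bm_act n V a i" unfolding bm_act_def by (intro Sup_fin.coboundedI) auto
qed

lemma bm_act_ge:
  "\<lbrakk>j \<in> {1..n}; V i j\<rbrakk> \<Longrightarrow> (a j::'m::lattice_ordered_additive_monoid) \<le> bm_act n V a i"
  unfolding bm_act_def by (intro Sup_fin.coboundedI) (force simp: scal_def)+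

lemma bm_act_zero_row:
  assumes "1 \<le> n" "\<And>j. j \<in> {1..n} \<Longrightarrow> \<not> V i j"
  shows "bm_act n V a i = (0::'m::lattice_ordered_additive_monoid)"
proof -
  have "(\<lambda>j. scal (V i j) (a j)) ` {1..n} = {0}" using assms by (force simp: scal_def)
  then show ?thesis by (simp add: bm_act_def)
qed

section \<open>Objects as noncrossing partitions with values\<close>

text \<open>The unpacked form of the object conditions. Of the three conclusions of \<open>T2_cond\<close> only one is kept, since
  the others follow by symmetry and transitivity; \<open>T3_cond\<close> is stated for consecutive members of
  a block; the equation \<open>bm_act n R v = v\<close> becomes constancy of the values on blocks, because the action of an equivalence
  relation replaces each value by the supremum over its block.\<close>

locale planar_obj =
  fixes n :: nat and R :: bmat and v :: "nat \<Rightarrow> 'm::lattice_ordered_additive_monoid"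
  assumes inr: "R i j \<Longrightarrow> i \<in> {1..n} \<and> j \<in> {1..n}"
    and v_out: "i \<notin> {1..n} \<Longrightarrow> v i = 0"
    and refl: "i \<in> {1..n} \<Longrightarrow> R i i"
    and sym: "R i j \<Longrightarrow> R j i"
    and trans: "R i j \<Longrightarrow> R j l \<Longrightarrow> R i l"
    and parity: "R i j \<Longrightarrow> even i \<longleftrightarrow> even j"
    and noncrossing: "\<lbrakk>a \<le> b; b \<le> c; c \<le> d; R a c; R b d\<rbrakk> \<Longrightarrow> R a b"
    and nested: "\<lbrakk>R a b; a < b; \<And>c. \<lbrakk>a < c; c < b\<rbrakk> \<Longrightarrow> \<not> R a c\<rbrakk> \<Longrightarrow> R (a + 1) (b - 1)"
    and const: "R i j \<Longrightarrow> v i = v j"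

lemma obj_set_iff:
  assumes "1 \<le> n"
  shows "(R, v) \<in> obj_set n \<longleftrightarrow> planar_obj n R v"
proof
  assume "(R, v) \<in> obj_set n"
  then have H: "is_bmat n n R" "is_array n v" "bm_le (bm_one n) R" "bm_transpose R = R"
    "bm_mult n R R = R" "T1_cond n R" "T2_cond n R" "T3_cond n R" "bm_act n R v = v"
    by (auto simp: obj_set_def)
  have r: "i \<in> {1..n} \<and> j \<in> {1..n}" if "R i j" for i j
    using H(1) that unfolding is_bmat_def by blast
  have s: "R j i" if "R i j" for i j using H(4) that by (metis bm_transpose_def)
  have le: "v j \<le> v i" if "R i j" for i j
    using bm_act_ge[of j n R i v] r[OF that] that H(9) by simp
  show "planar_obj n R v"
  proof
    show "v i = 0" if "i \<notin> {1..n}" for i using H(2) that unfolding is_array_def by blast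
    show "R i i" if "i \<in> {1..n}" for i using H(3) that unfolding bm_le_def bm_one_def by blast
    show "R i l" if "R i j" "R j l" for i j l
      using H(5) that r by (metis bm_mult_def)
    show "even i \<longleftrightarrow> even j" if "R i j" for i j
    proof -
      have "even \<bar>int i - int j\<bar>" using H(6) that r[OF that] unfolding T1_cond_def by blast
      then show ?thesis by simp
    qed
    show "R a b" if "a \<le> b" "b \<le> c" "c \<le> d" "R a c" "R b d" for a b c d
      using H(7) that r[OF that(4)] r[OF that(5)] unfolding T2_cond_def by blast
    show "R (a + 1) (b - 1)" if "R a b" "a < b" "\<And>c. \<lbrakk>a < c; c < b\<rbrakk> \<Longrightarrow> \<not> R a c" for a b
      using H(8) that r[OF that(1)] unfolding T3_cond_def by blast
    show "v i = v j" if "R i j" for i j using le[OF that] le[OF s[OF that]] by simp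
  qed (use r s in blast)+
next
  assume "planar_obj n R v"
  then interpret planar_obj n R v .
  have "bm_mult n R R = R"
    using trans refl inr by (intro ext) (metis bm_mult_def)
  moreover have "bm_act n R v i = v i" for i
  proof (cases "i \<in> {1..n}")
    case True
    then show ?thesis using refl const by (intro bm_act_eqI[of i]) (auto dest: const)
  next
    case False
    then show ?thesis using bm_act_zero_row[OF assms, of R i v] inr v_out by metis
  qed
  moreover have "T3_cond n R" unfolding T3_cond_def using nested by blast
  moreover have "T2_cond n R" unfolding T2_cond_def
    by (meson noncrossing sym trans)
  moreover have "T1_cond n R" unfolding T1_cond_def using parity by auto
  ultimately show "(R, v) \<in> obj_set n"
    unfolding obj_set_def is_bmat_def is_array_def bm_le_def bm_one_def
    using inr v_out refl sym by (auto simp: bm_transpose_def fun_eq_iff)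
qed

section \<open>Creating an arc\<close>

definition glue :: "nat \<Rightarrow> nat \<Rightarrow> nat" where
  "glue k i = (if i < k then i else i - 2)"

lemma glue_surj: "\<exists>a. a \<noteq> k \<and> glue k a = i"
  by (rule exI[of _ "if i < k then i else i + 2"]) (auto simp: glue_def)

lemma glue_commute:
  assumes "k + 2 \<le> l" "a \<noteq> k" "a \<noteq> l"
  shows "glue (l - 2) (glue k a) = glue k (glue l a)"
  using assms by (auto simp: glue_def)

lemma glue_eq_iff:
  assumes "2 \<le> k" "a \<noteq> k" "b \<noteq> k"
  shows "glue k a = glue k b \<longleftrightarrow> a = b \<or> (a = k - 1 \<and> b = k + 1) \<or> (a = k + 1 \<and> b = k - 1)"
  using assms by (auto simp: glue_def)

lemma matB_iff:
  assumes "admissible n k"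
  shows "matB n k i j \<longleftrightarrow> i \<noteq> k \<and> glue k i = j \<and> j \<in> {1..n}"
  using assms unfolding matB_def glue_def admissible_def by auto

lemma glue_range:
  assumes "admissible n k" "a \<noteq> k"
  shows "glue k a \<in> {1..n} \<longleftrightarrow> a \<in> {1..n + 2}"
  using assms unfolding glue_def admissible_def by auto

text \<open>No range restrictions appear: \<open>glue k\<close> sends indices outside \<open>{1..n + 2}\<close> to indices outside
  \<open>{1..n}\<close>, where matrices and arrays have their default values.\<close>

lemma T_hat_simps:
  assumes "planar_obj n R v" "admissible n k"
  shows "fst (T_hat n k (R, v)) a b \<longleftrightarrow>
      (a = k \<and> b = k) \<or> (a \<noteq> k \<and> b \<noteq> k \<and> R (glue k a) (glue k b))"
    and "snd (T_hat n k (R, v)) a = (if a = k then 0 else v (glue k a))"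
proof -
  interpret planar_obj n R v by fact
  have k: "k \<in> {1..n+2}" "1 \<le> n" using assms(2) by (auto simp: admissible_def)
  show "fst (T_hat n k (R, v)) a b \<longleftrightarrow>
      (a = k \<and> b = k) \<or> (a \<noteq> k \<and> b \<noteq> k \<and> R (glue k a) (glue k b))"
    unfolding T_hat_def using k inr
    by (auto simp: bm_add_def bm_mult_def bm_transpose_def matB_iff[OF assms(2)] matD_def)
  show "snd (T_hat n k (R, v)) a = (if a = k then 0 else v (glue k a))"
  proof (cases "a \<noteq> k \<and> glue k a \<in> {1..n}")
    case True
    then show ?thesis unfolding T_hat_def
      by (simp, intro bm_act_eqI[of "glue k a"]) (auto simp: matB_iff[OF assms(2)])
  next
    case False
    then have "bm_act n (matB n k) v a = 0"
      by (intro bm_act_zero_row k) (auto simp: matB_iff[OF assms(2)])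
    then show ?thesis unfolding T_hat_def using False v_out by auto
  qed
qed

lemma T_hat_planar_obj:
  assumes "planar_obj n R v" and adm: "admissible n k"
  shows "planar_obj (n + 2) (fst (T_hat n k (R, v))) (snd (T_hat n k (R, v)))"
proof -
  interpret planar_obj n R v by fact
  note S = T_hat_simps[OF assms]
  have k: "2 \<le> k" "k \<in> {1..n+2}" using adm by (auto simp: admissible_def)
  show ?thesis
  proof (unfold_locales, goal_cases)
    case (1 i j)
    then show ?case using inr[of "glue k i" "glue k j"] glue_range[OF adm] k by (auto simp: S)
  next
    case (2 i)
    then have "i \<noteq> k" using k by auto
    moreover from this have "glue k i \<notin> {1..n}" using 2 glue_range[OF adm, of i] by blast
    ultimately show ?case using v_out by (simp add: S)
  next
    case (3 i)
    then show ?case using refl glue_range[OF adm, of i] by (auto simp: S)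
  next
    case (4 i j)
    then show ?case using sym by (auto simp: S)
  next
    case (5 i j l)
    then show ?case using trans by (auto simp: S)
  next
    case (6 i j)
    have "even (glue k a) = even a" if "a \<noteq> k" for a using that k(1) by (auto simp: glue_def)
    then show ?case using parity 6 by (auto simp: S)
  next
    case (7 a b c d)
    have mono: "glue k x \<le> glue k y" if "x \<le> y" "x \<noteq> k" "y \<noteq> k" for x y
      using that by (auto simp: glue_def)
    show ?case
    proof (cases "a = k \<or> b = k")
      case True
      then show ?thesis using 7 by (auto simp: S)
    next
      case False
      then show ?thesis using 7 mono noncrossing[of "glue k a" "glue k b" "glue k c" "glue k d"]
        by (auto simp: S)
    qed
  next
    case (8 a b)
    then have ab: "a \<noteq> k" "b \<noteq> k" "R (glue k a) (glue k b)" by (auto simp: S)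
    have nb: "\<not> R (glue k a) (glue k c)" if "a < c" "c < b" "c \<noteq> k" for c
      using 8(3)[OF that(1,2)] ab that(3) by (auto simp: S)
    show ?case
    proof (cases "glue k a = glue k b")
      case True
      then have "a = k - 1 \<and> b = k + 1" using ab 8(2) k(1) glue_eq_iff[OF k(1) ab(1,2)] by auto
      then show ?thesis using k by (auto simp: S)
    next
      case False
      have l: "glue k a < glue k b" using False 8(2) ab by (auto simp: glue_def split: if_splits)
      have r: "R (glue k a) (glue k a)" using trans ab sym by blast
      have "a + 1 \<noteq> k"
      proof
        assume "a + 1 = k"
        moreover from this have "k + 1 < b" using l ab by (simp add: glue_def split: if_splits)
        ultimately show False using nb[of "k + 1"] r ab by (auto simp: glue_def)
      qed
      moreover have "b - 1 \<noteq> k"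
      proof
        assume "b - 1 = k"
        moreover from this have "a < k - 1" using l ab by (simp add: glue_def split: if_splits)
        moreover have "glue k (k - 1) = glue k b"
          using \<open>b - 1 = k\<close> k(1) by (auto simp: glue_def)
        moreover have "k - 1 < b" "k - 1 \<noteq> k" using \<open>b - 1 = k\<close> k(1) by auto
        ultimately show False using nb[of "k - 1"] ab(3) by simp
      qed
      moreover have "R (glue k a + 1) (glue k b - 1)"
      proof (rule nested[OF ab(3) l])
        fix c assume c: "glue k a < c" "c < glue k b"
        obtain c' where "c' \<noteq> k" "glue k c' = c" using glue_surj by blast
        moreover from this have "a < c'" "c' < b" using c ab
          by (auto simp: glue_def split: if_splits)
        ultimately show "\<not> R (glue k a) c" using nb by blast
      qed
      moreover have "glue k (a + 1) = glue k a + 1" using ab calculation(1) k(1) by (auto simp: glue_def)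
      moreover have "glue k (b - 1) = glue k b - 1" using ab calculation(2) k(1) by (auto simp: glue_def)
      ultimately show ?thesis by (simp add: S)
    qed
  next
    case (9 i j)
    then show ?case using const by (auto simp: S)
  qed
qed

section \<open>Closing an arc\<close>

text \<open>For an equivalence relation \<open>R\<close>, the smallest equivalence relation containing \<open>R\<close> and
  \<open>(k - 1, k + 1)\<close>, before region \<open>k\<close> is removed. Keeping the old indices lets closures of several arcs be compared without renumbering.\<close>

definition merge :: "bmat \<Rightarrow> nat \<Rightarrow> bmat" where
  "merge R k a b \<longleftrightarrow> R a b \<or> (R a (k - 1) \<and> R (k + 1) b) \<or> (R a (k + 1) \<and> R (k - 1) b)"

lemma (in planar_obj) merge_sym: "merge R k a b \<Longrightarrow> merge R k b a"
  using sym by (auto simp: merge_def)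

lemma (in planar_obj) merge_trans: "\<lbrakk>merge R k a b; merge R k b c\<rbrakk> \<Longrightarrow> merge R k a c"
  unfolding merge_def by (elim disjE conjE) (meson sym trans)+

definition merge_val ::
    "('m \<Rightarrow> 'm) \<Rightarrow> bmat \<Rightarrow> (nat \<Rightarrow> 'm) \<Rightarrow> nat \<Rightarrow> nat \<Rightarrow> 'm::lattice_ordered_additive_monoid" where
  "merge_val \<phi> R v k a = (if R a (k - 1) \<or> R a (k + 1)
     then v (k - 1) + (if R (k - 1) (k + 1) then \<phi> (v k) else v (k + 1)) else v a)"

text \<open>The square in the definition of the new relation is what makes it transitive: a chain through
  \<open>P\<close> can only switch blocks at the glued region \<open>k - 1\<close>, so two steps suffice.\<close>

lemma T_check_simps:
  assumes "planar_obj (n + 2) R v" and adm: "admissible n k"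
  shows T_check_rel: "\<lbrakk>a \<noteq> k; b \<noteq> k\<rbrakk> \<Longrightarrow>
      fst (T_check \<phi> n k (R, v)) (glue k a) (glue k b) \<longleftrightarrow> merge R k a b"
    and T_check_val: "a \<noteq> k \<Longrightarrow> snd (T_check \<phi> n k (R, v)) (glue k a) = merge_val \<phi> R v k a"
proof -
  interpret planar_obj "n + 2" R v by fact
  have k: "2 \<le> k" "k \<in> {1..n+2}" "1 \<le> n" "k - 1 \<in> {1..n+2}" "k + 1 \<in> {1..n+2}"
    using adm by (auto simp: admissible_def)
  have kk: "R (k - 1) (k - 1)" "R (k + 1) (k + 1)" using refl k by auto
  define P where "P = bm_mult (n + 2) (bm_mult (n + 2) (bm_transpose (matB n k)) R) (matB n k)"
  define R' where "R' = bm_mult n P P"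
  have P: "P i j \<longleftrightarrow> (\<exists>a b. a \<noteq> k \<and> b \<noteq> k \<and> glue k a = i \<and> glue k b = j \<and> R a b)" for i j
  proof -
    have "R a b \<Longrightarrow> a \<noteq> k \<Longrightarrow> b \<noteq> k \<Longrightarrow> a \<in> {1..n+2} \<and> b \<in> {1..n+2} \<and>
        glue k a \<in> {1..n} \<and> glue k b \<in> {1..n}" for a b
      using inr[of a b] glue_range[OF adm] by blast
    then show ?thesis unfolding P_def bm_mult_def bm_transpose_def matB_iff[OF adm] by metis
  qed
  have Pr: "P i j \<Longrightarrow> i \<in> {1..n} \<and> j \<in> {1..n}" for i j
    using inr glue_range[OF adm] unfolding P by blast
  \<comment> \<open>one step of \<open>P\<close> relates chosen representatives up to swapping \<open>k - 1\<close> and \<open>k + 1\<close>\<close>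
  have Pm: "P (glue k a) (glue k b) \<longleftrightarrow> R a b \<or> (a = k - 1 \<and> R (k + 1) b) \<or> (a = k + 1 \<and> R (k - 1) b)
      \<or> (b = k - 1 \<and> R a (k + 1)) \<or> (b = k + 1 \<and> R a (k - 1)) \<or>
      (a \<in> {k - 1, k + 1} \<and> b \<in> {k - 1, k + 1})" (is "_ \<longleftrightarrow> ?Q")
    if ab: "a \<noteq> k" "b \<noteq> k" for a b
  proof
    assume "P (glue k a) (glue k b)"
    then obtain a' b' where "a' \<noteq> k" "b' \<noteq> k" "glue k a = glue k a'" "glue k b = glue k b'" "R a' b'"
      unfolding P by metis
    then show ?Q using glue_eq_iff[OF k(1), of a a'] glue_eq_iff[OF k(1), of b b'] ab by auto
  next
    have kn: "k - 1 \<noteq> k" "k + 1 \<noteq> k" "glue k (k - 1) = glue k (k + 1)"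
      using k(1) by (auto simp: glue_def)
    assume ?Q
    then show "P (glue k a) (glue k b)"
      unfolding P using kn ab kk by (elim disjE) (metis empty_iff insert_iff)+
  qed
  have Pmerge: "merge R k a b" if "a \<noteq> k" "b \<noteq> k" "P (glue k a) (glue k b)" for a b
    using that(3) kk unfolding Pm[OF that(1,2)] merge_def by auto
  have R'm: "R' (glue k a) (glue k b) \<longleftrightarrow> merge R k a b" if ab: "a \<noteq> k" "b \<noteq> k" for a b
  proof -
    have "R' (glue k a) (glue k b) \<longleftrightarrow> (\<exists>c. c \<noteq> k \<and> P (glue k a) (glue k c) \<and> P (glue k c) (glue k b))"
      unfolding R'_def bm_mult_def using Pr glue_surj[of k] by metis
    also have "\<dots> \<longleftrightarrow> merge R k a b" (is "?L \<longleftrightarrow> _")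
    proof
      assume ?L
      then obtain c where c: "c \<noteq> k" "P (glue k a) (glue k c)" "P (glue k c) (glue k b)" by blast
      show "merge R k a b"
        using merge_trans[OF Pmerge[OF ab(1) c(1) c(2)] Pmerge[OF c(1) ab(2) c(3)]] .
    next
      assume m: "merge R k a b"
      have "R a b \<Longrightarrow> R b b" using trans sym by blast
      with m show ?L unfolding merge_def
        apply (elim disjE conjE)
        subgoal by (rule exI[of _ b]) (simp add: Pm ab)
        subgoal by (rule exI[of _ "k - 1"]) (use k(1) in \<open>simp add: Pm ab\<close>)
        subgoal by (rule exI[of _ "k + 1"]) (use k(1) in \<open>simp add: Pm ab\<close>)
        done
    qed
    finally show ?thesis .
  qed
  define x where "x = (if R (k - 1) (k + 1) then \<phi> (v k) else inf (v (k - 1)) (v (k + 1)))"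
  define w where "w = array_add (bm_act (n + 2) (bm_transpose (matB n k)) v) (col_act (col_e n (k - 1)) x)"
  have T: "T_check \<phi> n k (R, v) = (R', bm_act n R' w)"
    unfolding T_check_def P_def R'_def x_def w_def by (simp add: Let_def)
  show "fst (T_check \<phi> n k (R, v)) (glue k a) (glue k b) \<longleftrightarrow> merge R k a b"
    if "a \<noteq> k" "b \<noteq> k" using R'm[OF that] T by simp
  have gk: "glue k (k - 1) = k - 1" "glue k (k + 1) = k - 1" "k - 1 \<in> {1..n}"
    using k by (auto simp: glue_def)
  let ?p = "v (k - 1)" and ?q = "v (k + 1)"
  have w1: "w (glue k a) = v a" if "a \<noteq> k" "glue k a \<noteq> k - 1" "a \<in> {1..n+2}" for a
  proof -
    have "bm_act (n + 2) (bm_transpose (matB n k)) v (glue k a) = v a"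
      using that glue_range[OF adm that(1)] glue_eq_iff[OF k(1)] gk
      by (intro bm_act_eqI[of a]) (auto simp: bm_transpose_def matB_iff[OF adm])
    then show ?thesis using that(2) by (simp add: w_def array_add_def col_act_def col_e_def scal_def)
  qed
  have w2: "w (k - 1) = sup ?p ?q + x"
  proof -
    have "bm_act (n + 2) (bm_transpose (matB n k)) v (k - 1) = sup ?p ?q"
    proof (rule antisym)
      show "sup ?p ?q \<le> bm_act (n + 2) (bm_transpose (matB n k)) v (k - 1)"
        using k gk by (intro sup_least bm_act_ge) (auto simp: bm_transpose_def matB_iff[OF adm])
      have "scal (bm_transpose (matB n k) (k - 1) j) (v j) \<le> sup ?p ?q" for j
      proof (cases "j \<noteq> k \<and> glue k j = k - 1")
        case True
        then have "j = k - 1 \<or> j = k + 1"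
          using glue_eq_iff[OF k(1), of j "k - 1"] k(1) gk(1) by force
        then show ?thesis by (auto simp: scal_def loam_zero_le)
      qed (auto simp: bm_transpose_def matB_iff[OF adm] scal_def loam_zero_le)
      then show "bm_act (n + 2) (bm_transpose (matB n k)) v (k - 1) \<le> sup ?p ?q"
        unfolding bm_act_def by (intro Sup_fin.boundedI) auto
    qed
    then show ?thesis using gk by (simp add: w_def array_add_def col_act_def col_e_def scal_def)
  qed
  have w3: "w (k - 1) = ?p + (if R (k - 1) (k + 1) then \<phi> (v k) else ?q)"
    using const[of "k - 1" "k + 1"] loam_sup_add_inf[of ?p ?q] unfolding w2 x_def by auto
  have w4: "?p \<le> w (k - 1)" "?q \<le> w (k - 1)"
    unfolding w2 using loam_add_left_mono[OF loam_zero_le, of "sup ?p ?q" x]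
    by (simp_all add: le_supI1 le_supI2)
  show "snd (T_check \<phi> n k (R, v)) (glue k a) = merge_val \<phi> R v k a" if a: "a \<noteq> k"
  proof (cases "a \<in> {1..n + 2}")
    case False
    then have "bm_act n R' w (glue k a) = 0"
      using glue_range[OF adm a] k(3) Pr unfolding R'_def bm_mult_def
      by (intro bm_act_zero_row) auto
    moreover have "merge_val \<phi> R v k a = 0" using False v_out inr unfolding merge_val_def by auto
    ultimately show ?thesis using T by simp
  next
    case True
    show ?thesis
    proof (cases "R a (k - 1) \<or> R a (k + 1)")
      case t: True
      have "bm_act n R' w (glue k a) = w (k - 1)"
      proof (rule bm_act_eqI[of "k - 1"])
        have "merge R k a (k - 1)" using t kk unfolding merge_def by auto
        then show "R' (glue k a) (k - 1)" using R'm[OF a, of "k - 1"] gk k by auto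
        fix j assume "j \<in> {1..n}" "R' (glue k a) j"
        moreover obtain b where b: "b \<noteq> k" "glue k b = j" using glue_surj by blast
        ultimately have m: "merge R k a b" using R'm[OF a] by blast
        show "w j \<le> w (k - 1)"
        proof (cases "j = k - 1")
          case False
          have "b \<in> {1..n+2}" using m inr unfolding merge_def by blast
          then have "w j = v b" using b w1[of b] False by simp
          moreover have "R b (k - 1) \<or> R b (k + 1)"
            using m t trans sym unfolding merge_def by blast
          ultimately show ?thesis using const w4 by metis
        qed simp
      qed (use gk in auto)
      then show ?thesis using t w3 T by (simp add: merge_val_def)
    next
      case f: False
      have ne: "glue k a \<noteq> k - 1"
        using f kk a glue_eq_iff[OF k(1), of a "k - 1"] gk k(1) by auto
      have "bm_act n R' w (glue k a) = v a"
      proof (rule bm_act_eqI[of "glue k a"])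
        show "glue k a \<in> {1..n}" using glue_range[OF adm a] True by simp
        show "R' (glue k a) (glue k a)" using R'm[OF a a] refl True by (auto simp: merge_def)
        show "w (glue k a) = v a" using w1[OF a ne True] .
        fix j assume "j \<in> {1..n}" "R' (glue k a) j"
        moreover obtain b where b: "b \<noteq> k" "glue k b = j" using glue_surj by blast
        ultimately have m: "merge R k a b" using R'm[OF a] by blast
        then have Rab: "R a b" using f unfolding merge_def by blast
        then have "glue k b \<noteq> k - 1"
          using f glue_eq_iff[OF k(1), of b "k - 1"] b gk k(1) by auto
        then have "w j = v b" using w1[of b] b inr[OF Rab] by simp
        then show "w j \<le> v a" using const[OF Rab] by simp
      qed
      then show ?thesis using f T by (simp add: merge_val_def)
    qed
  qed
qed

context planar_obj
begin

text \<open>If \<open>k - 1\<close> and \<open>k + 1\<close> are connected, a connection of \<open>k\<close> with anything else would cross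
  theirs, and would then connect \<open>k\<close> with a neighbour, against parity.\<close>

lemma isolated:
  assumes "R (k - 1) (k + 1)" "R k a"
  shows "a = k"
proof (rule ccontr)
  assume "a \<noteq> k"
  have k1: "1 \<le> k - 1" using inr[OF assms(1)] by auto
  consider "a < k" | "k < a" using \<open>a \<noteq> k\<close> by linarith
  then have "R (k - 1) k"
  proof cases
    case 1
    then have "R a (k - 1)"
      using noncrossing[of a "k - 1" k "k + 1"] sym[OF assms(2)] assms(1) by simp
    then show ?thesis using trans sym assms(2) by blast
  next
    case 2
    then show ?thesis using noncrossing[of "k - 1" k "k + 1" a] assms by simp
  qed
  then show False using parity[of "k - 1" k] k1 by (cases k) auto
qed

lemma merge_parity: "2 \<le> k \<Longrightarrow> merge R k a b \<Longrightarrow> even a \<longleftrightarrow> even b"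
  using parity[of a b] parity[of a "k - 1"] parity[of "k + 1" b] parity[of a "k + 1"] parity[of "k - 1" b]
  unfolding merge_def by auto

text \<open>The points \<open>k - 1\<close> and \<open>k + 1\<close> are adjacent once \<open>k\<close> is disregarded, so a crossing of a united block
  with another block is already a crossing of one of its two halves.\<close>

lemma merge_noncrossing:
  assumes le: "a \<le> b" "b \<le> c" "c \<le> d" and nk: "a \<noteq> k" "b \<noteq> k" "c \<noteq> k" "d \<noteq> k"
    and m: "merge R k a c" "merge R k b d"
  shows "merge R k a b"
proof (cases "R (k - 1) (k + 1)")
  case True
  then have "R a c" "R b d" using m trans sym unfolding merge_def by blast+
  then show ?thesis using noncrossing[OF le] by (simp add: merge_def)
next
  case False
  define p q where "p = k - 1" and "q = k + 1"
  have pq: "x \<le> p \<or> q \<le> x" if "x \<noteq> k" for x using that unfolding p_def q_def by linarith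
  have lt: "p < q" unfolding p_def q_def by linarith
  have mm: "merge R k x y \<longleftrightarrow> R x y \<or> R x p \<and> R q y \<or> R x q \<and> R p y" for x y
    unfolding merge_def p_def q_def ..
  have npq: "\<not> R p q" using False by (simp add: p_def q_def)
  from m show ?thesis unfolding mm
    using pq[OF nk(1)] pq[OF nk(2)] pq[OF nk(3)] pq[OF nk(4)] lt le npq
    by (smt (verit, best) noncrossing sym trans order_trans less_imp_le)
qed

text \<open>The geometric core of the preservation of \<open>T3_cond\<close>. The points \<open>a\<close> and \<open>b\<close> are taken as representatives
  nearest to each other, hence \<open>a \<noteq> k - 1\<close> and \<open>b \<noteq> k + 1\<close>. If \<open>R a b\<close>, then \<open>k\<close> is the only possible
  member of the block between them, and \<open>T3_cond\<close> on both sides of \<open>k\<close> gives regions that are glued.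
  Otherwise noncrossing leaves a block \<open>k - 1, b\<close> arching over the block \<open>k + 1, \<dots>, a\<close>, or the mirror
  image \<open>a, k + 1\<close> over \<open>b, \<dots>, k - 1\<close>. Below the outer block lies the block of \<open>k\<close>, and \<open>T3_cond\<close> for \<open>k\<close>
  and its neighbour \<open>d\<close> in that block forces \<open>d = a + 1\<close> or \<open>d = b - 1\<close>, respectively.\<close>

lemma merge_nested:
  assumes k: "2 \<le> k" "k + 1 \<le> n"
    and a: "a \<noteq> k - 1" "a \<noteq> k" and b: "b \<noteq> k" "b \<noteq> k + 1" and ab: "a < b"
    and m: "merge R k a b"
    and free: "\<And>c. \<lbrakk>c \<noteq> k; a < c; c < b\<rbrakk> \<Longrightarrow> \<not> merge R k a c"
  shows "merge R k (a + 1) (b - 1)"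
proof -
  define p q where "p = k - 1" and "q = k + 1"
  have pq: "p < k" "k < q" "p + 1 = k" "q = k + 1" using k by (auto simp: p_def q_def)
  have rpq: "R p p" "R q q" by (rule refl; use k in \<open>auto simp: p_def q_def\<close>)+
  have mm: "merge R k x y \<longleftrightarrow> R x y \<or> R x p \<and> R q y \<or> R x q \<and> R p y" for x y
    unfolding merge_def p_def q_def ..
  have nkq: "\<not> R k q" "\<not> R p k" using parity[of k q] parity[of p k] pq by auto
  have ap: "a \<noteq> p" "b \<noteq> q" using a b by (auto simp: p_def q_def)
  show ?thesis
  proof (cases "R a b")
    case True
    show ?thesis
    proof (cases "\<exists>c. a < c \<and> c < b \<and> R a c")
      case False
      then have "R (a + 1) (b - 1)" using nested[OF True ab] by blast
      then show ?thesis by (simp add: mm)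
    next
      case t: True
      then obtain c where c: "a < c" "c < b" "R a c" by blast
      then have "c = k" using free[of c] mm by blast
      then have kk: "a < k" "k < b" "R a k" using c by auto
      have fr: "\<not> R a x" if "x \<noteq> k" "a < x" "x < b" for x
        using free[OF that] unfolding mm by blast
      have Rkb: "R k b" using sym trans True kk by blast
      have "R (a + 1) (k - 1)" by (rule nested[OF kk(3,1)]) (use fr kk in auto)
      moreover have "R (k + 1) (b - 1)"
      proof (rule nested[OF Rkb kk(2)])
        fix x assume "k < x" "x < b"
        then have "\<not> R a x" using fr[of x] kk by simp
        then show "\<not> R k x" using kk trans by blast
      qed
      ultimately show ?thesis by (simp add: merge_def)
    qed
  next
    case nab: False
    then consider "R a p" "R q b" | "R a q" "R p b" using m mm by blast
    then show ?thesis
    proof cases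
      case 1
      have "\<not> merge R k a p" if "a < p" "p < b" using free[of p] that pq by simp
      then have "q \<le> a \<or> b \<le> p" using 1 mm rpq ap a ab pq by (metis Suc_eq_plus1 Suc_leI less_Suc_eq linorder_not_le)
      then show ?thesis
      proof
        assume "q \<le> a"
        then have "R p q" using noncrossing[of p q a b] 1 sym pq ab by simp
        then show ?thesis using nab 1 trans by blast
      next
        assume "b \<le> p"
        then have "R a b" using noncrossing[of a b p q] 1 sym pq ab by simp
        then show ?thesis using nab by blast
      qed
    next
      case 2
      have "\<not> merge R k a p" if "a < p" "p < b" using free[of p] that pq by simp
      then have "q \<le> a \<or> b \<le> p" using 2 mm rpq ap a ab pq by (metis Suc_eq_plus1 Suc_leI less_Suc_eq linorder_not_le)
      then show ?thesis
      proof
        assume qa: "q \<le> a"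
        have npq: "\<not> R p q" using 2 nab trans sym by blast
        have "R (p + 1) (b - 1)"
        proof (rule nested)
          fix c assume c: "p < c" "c < b"
          show "\<not> R p c"
          proof
            assume R: "R p c"
            then have "c \<noteq> k" "c \<noteq> q" using nkq npq by auto
            then have cq: "q < c" using c pq by linarith
            have "merge R k a c" using R 2 mm by blast
            then have "c \<le> a" using free[OF \<open>c \<noteq> k\<close>] c by (meson linorder_not_le)
            then have "R p q" using noncrossing[of p q c a] cq pq R 2 sym by simp
            then show False using npq by blast
          qed
        qed (use 2 pq qa ab in auto)
        then have Rk: "R k (b - 1)" using pq by simp
        define d where "d = (LEAST d. k < d \<and> R k d)"
        have ex: "k < b - 1 \<and> R k (b - 1)" using Rk qa ab pq by linarith
        have d: "k < d" "R k d" unfolding d_def using LeastI[of "\<lambda>d. k < d \<and> R k d", OF ex] by auto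
        have dl: "d \<le> b - 1" unfolding d_def using Least_le[of "\<lambda>d. k < d \<and> R k d", OF ex] .
        have "R (k + 1) (d - 1)"
        proof (rule nested[OF d(2,1)])
          fix c assume "k < c" "c < d"
          then show "\<not> R k c" using not_less_Least[of c "\<lambda>d. k < d \<and> R k d"] by (simp add: d_def)
        qed
        then have Rd: "R q (d - 1)" using pq by simp
        have "d - 1 \<noteq> k" using Rd nkq sym by metis
        moreover have "merge R k a (d - 1)" using Rd 2 trans mm by blast
        moreover have "d - 1 < b" using dl ab by linarith
        ultimately have "d - 1 \<le> a" using free[of "d - 1"] by (meson linorder_not_le)
        moreover have "\<not> d \<le> a"
        proof
          assume "d \<le> a"
          moreover have "q \<le> d" using d pq by simp
          ultimately have "R k q" using noncrossing[of k q d a] d sym 2 pq by simp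
          then show False using nkq by blast
        qed
        ultimately have "a + 1 = d" by linarith
        then have "R (a + 1) (b - 1)" using d Rk sym trans by blast
        then show ?thesis by (simp add: mm)
      next
        assume bp: "b \<le> p"
        have npq: "\<not> R a p" using 2 nab trans sym by blast
        have "R (a + 1) (q - 1)"
        proof (rule nested)
          fix c assume c: "a < c" "c < q"
          show "\<not> R a c"
          proof
            assume R: "R a c"
            then have "c \<noteq> k" "c \<noteq> p" using nkq npq 2 sym trans by blast+
            then have cq: "c < p" using c pq by linarith
            have "merge R k a c" using R mm by blast
            then have "b \<le> c" using free[OF \<open>c \<noteq> k\<close>] c by (meson linorder_not_le)
            then have "R a b" using noncrossing[of a b c p] cq pq R 2 sym ab by simp
            then show False using nab by blast
          qed
        qed (use 2 pq bp ab in auto)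
        then have Rk: "R (a + 1) k" using pq by simp
        define d where "d = (GREATEST d. d < k \<and> R d k)"
        have ex: "a + 1 < k \<and> R (a + 1) k" using Rk bp ab pq by linarith
        have bd: "y \<le> k" if "y < k \<and> R y k" for y using that by simp
        have d: "d < k" "R d k" unfolding d_def
          using GreatestI_nat[of "\<lambda>d. d < k \<and> R d k", OF ex bd] by auto
        have dl: "a + 1 \<le> d" unfolding d_def
          using Greatest_le_nat[of "\<lambda>d. d < k \<and> R d k", OF ex bd] .
        have "R (d + 1) (k - 1)"
        proof (rule nested[OF d(2,1)])
          fix c assume c: "d < c" "c < k"
          show "\<not> R d c"
          proof
            assume "R d c"
            then have "c < k \<and> R c k" using c d sym trans by blast
            then have "c \<le> d" unfolding d_def
              using Greatest_le_nat[of "\<lambda>d. d < k \<and> R d k", OF _ bd] by blast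
            then show False using c by simp
          qed
        qed
        then have Rd: "R p (d + 1)" using p_def sym by simp
        have "d + 1 \<noteq> k" using Rd nkq by metis
        moreover have "merge R k a (d + 1)" using Rd 2 mm by blast
        moreover have "a < d + 1" using dl by linarith
        ultimately have "b \<le> d + 1" using free[of "d + 1"] by (meson linorder_not_le)
        moreover have "\<not> b \<le> d"
        proof
          assume "b \<le> d"
          moreover have "d \<le> p" using d pq by simp
          ultimately have "R b d" using noncrossing[of b d p k] d sym 2 pq by simp
          then have "R p k" using 2 d trans by blast
          then show False using nkq by blast
        qed
        ultimately have "b - 1 = d" by linarith
        then have "R (a + 1) (b - 1)" using d Rk sym trans by blast
        then show ?thesis by (simp add: mm)
      qed
    qed
  qed
qed

lemma merge_val_const:
  assumes "merge R k a b" shows "merge_val \<phi> R v k a = merge_val \<phi> R v k b"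
proof -
  have "(R a (k - 1) \<or> R a (k + 1)) \<longleftrightarrow> (R b (k - 1) \<or> R b (k + 1))"
    using assms trans sym unfolding merge_def by meson
  moreover have "v a = v b" if "\<not> (R a (k - 1) \<or> R a (k + 1))"
    using const that assms unfolding merge_def by blast
  ultimately show ?thesis by (auto simp: merge_val_def)
qed

lemma merge_commute: "merge (merge R k) l a b \<longleftrightarrow> merge (merge R l) k a b"
  unfolding merge_def using sym trans by (smt (verit))

text \<open>With \<open>p, q\<close> the regions united by the first arc and \<open>r, s\<close> those united by the second, an arc
  encloses a component exactly when the regions it unites are connected before it is closed. Which
  arcs do so depends on the order only in the nested configuration \<open>R p s\<close>, \<open>R q r\<close>, where the arc
  closed last encloses the component of \<open>k\<close> and \<open>l\<close>. The remaining possibility \<open>R p r\<close>, \<open>R q s\<close>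
  is a crossing. In every case the value of the resulting block is the same sum in different order.\<close>

lemma merge_val_commute:
  assumes k: "2 \<le> k" "k + 2 \<le> l" "l + 1 \<le> n" and a: "a \<noteq> k" "a \<noteq> l"
  shows "merge_val \<phi> (merge R k) (merge_val \<phi> R v k) l a =
    merge_val \<phi> (merge R l) (merge_val \<phi> R v l) k a"
proof -
  define p q r s where "p = k - 1" and "q = k + 1" and "r = l - 1" and "s = l + 1"
  have le: "p < k" "k < q" "q \<le> r" "r < l" "l < s" "p + 1 = k" "s - 1 = l" "q = k + 1" "l = r + 1" "s = l + 1"
    using k by (auto simp: p_def q_def r_def s_def)
  have re: "R p p" "R q q" "R r r" "R s s"
    by (rule refl; use k in \<open>auto simp: p_def q_def r_def s_def\<close>)+
  have m1: "merge R k x y \<longleftrightarrow> R x y \<or> R x p \<and> R q y \<or> R x q \<and> R p y" for x y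
    unfolding merge_def p_def q_def ..
  have m2: "merge R l x y \<longleftrightarrow> R x y \<or> R x r \<and> R s y \<or> R x s \<and> R r y" for x y
    unfolding merge_def r_def s_def ..
  have v1: "merge_val \<phi> S w k x = (if S x p \<or> S x q
     then w p + (if S p q then \<phi> (w k) else w q) else w x)" for S w x
    unfolding merge_val_def p_def q_def ..
  have v2: "merge_val \<phi> S w l x = (if S x r \<or> S x s
     then w r + (if S r s then \<phi> (w l) else w s) else w x)" for S w x
    unfolding merge_val_def r_def s_def ..
  have isok: "x = k" if "R p q" "R k x" for x using isolated[of k x] that by (simp add: p_def q_def)
  have isol: "x = l" if "R r s" "R l x" for x using isolated[of l x] that by (simp add: r_def s_def)
  have enclosed: "R k l" if c: "\<not> R p q" "R p s" "R q r"
  proof -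
    have "R (p + 1) (s - 1)"
    proof (rule nested[OF c(2)])
      fix x assume x: "p < x" "x < s"
      show "\<not> R p x"
      proof
        assume R: "R p x"
        have "R s x" using R c(2) sym trans by blast
        then have "x \<noteq> k" "x \<noteq> l" using parity[OF R] parity[of s x] le(6,10) by auto
        then have "q \<le> x" "x \<le> r" using x le by auto
        then have "R p q" using noncrossing[of p q x r] le R c(3) by simp
        then show False using c(1) by blast
      qed
    qed (use le in simp)
    then show ?thesis using le by simp
  qed
  have crossing: "R p q" if "R p r" "R q s"
    using noncrossing[of p q r s] le that by simp
  have nkl: "\<not> R k p" "\<not> R k q" "\<not> R l r" "\<not> R l s"
    using parity[of k p] parity[of k q] parity[of l r] parity[of l s] le(6,8-10) by auto
  \<comment> \<open>equations between blocks instead of relations, so that the case distinctions are closed by rewriting\<close>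
  define C where "C x = {y. R x y}" for x
  have C0: "R x y \<longleftrightarrow> C x = C y" if "R y y" for x y
    unfolding C_def using that trans sym by blast
  have C: "R x p \<longleftrightarrow> C x = C p" "R x q \<longleftrightarrow> C x = C q" "R x r \<longleftrightarrow> C x = C r" "R x s \<longleftrightarrow> C x = C s" for x
    using C0 re by blast+
  define w where "w X = v (SOME y. y \<in> X)" for X
  have w: "v x = w (C x)" if "R x x" for x
  proof -
    have "R x (SOME y. y \<in> C x)" using someI[of "\<lambda>y. y \<in> C x" x] that by (simp add: C_def)
    then show ?thesis using const by (simp add: w_def)
  qed
  note vw = w[OF re(1)] w[OF re(2)] w[OF re(3)] w[OF re(4)]
  let ?V1 = "merge_val \<phi> R v k" and ?V2 = "merge_val \<phi> R v l"
  have cases: "(R p q \<and> R r s) \<or> (\<not> R p q \<and> R r s \<and> \<not> merge R l p q)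
      \<or> (R p q \<and> \<not> R r s \<and> \<not> merge R k r s) \<or> (\<not> R p q \<and> \<not> R r s \<and> R p s \<and> R q r)
      \<or> (\<not> R p q \<and> \<not> R r s \<and> \<not> merge R l p q \<and> \<not> merge R k r s)"
    unfolding m1 m2 using crossing sym trans by meson
  then consider (both) "R p q" "R r s" | (right) "\<not> R p q" "R r s" "\<not> merge R l p q"
    | (left) "R p q" "\<not> R r s" "\<not> merge R k r s" | (around) "\<not> R p q" "\<not> R r s" "R p s" "R q r"
    | (none) "\<not> R p q" "\<not> R r s" "\<not> merge R l p q" "\<not> merge R k r s"
    by blast
  then show ?thesis
  proof cases
    case both
    have "?V1 l = v l" "?V2 k = v k" using isok isol both le sym unfolding v1 v2 by force+
    moreover have "merge R k r s" "merge R l p q" using both m1 m2 by auto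
    ultimately show ?thesis using both
      unfolding v1[of "merge R l"] v2[of "merge R k"] by (auto simp: v1 v2 m1 m2 C vw add_ac)
  next
    case right
    have "?V1 l = v l" using isol right le sym unfolding v1 v2 by force+
    moreover have "merge R k r s" using right m1 m2 by auto
    moreover have "merge R l = R" using right(2) trans sym by (intro ext) (meson m2)
    ultimately show ?thesis using right
      unfolding v1[of "merge R l"] v2[of "merge R k"]
      by (cases "C p = C r"; cases "C q = C r"; cases "C a = C p"; cases "C a = C q";
        cases "C a = C r"; simp add: v1 v2 m1 C vw add_ac)
  next
    case left
    have "?V2 k = v k" using isok left le sym unfolding v1 v2 by force+
    moreover have "merge R l p q" using left m1 m2 by auto
    moreover have "merge R k = R" using left(1) trans sym by (intro ext) (meson m1)
    ultimately show ?thesis using left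
      unfolding v1[of "merge R l"] v2[of "merge R k"]
      by (cases "C r = C p"; cases "C s = C p"; cases "C a = C r"; cases "C a = C s";
        cases "C a = C p"; simp add: v1 v2 m2 C vw add_ac)
  next
    case around
    then have "R k l" using enclosed by blast
    then have "?V1 l = v l" "?V2 k = v l" using nkl sym trans const unfolding v1 v2 by metis+
    moreover have "merge R k r s" "merge R l p q" using around m1 m2 sym by blast+
    moreover have "C s = C p" "C r = C q" using around C by auto
    ultimately show ?thesis using around(1,2)
      unfolding v1[of "merge R l"] v2[of "merge R k"]
      by (cases "C a = C p"; cases "C a = C q"; simp add: v1 v2 m1 m2 C vw add_ac)
  next
    case none
    have N: "C p \<noteq> C q" "C r \<noteq> C s" "\<not> (C p = C r \<and> C q = C s)" "\<not> (C p = C s \<and> C q = C r)"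
      using none unfolding m1 m2 C by metis+
    have V1: "?V1 x = (if C x = C p \<or> C x = C q then w (C p) + w (C q) else v x)" for x
      using N(1) by (simp add: v1 C vw)
    have V2: "?V2 x = (if C x = C r \<or> C x = C s then w (C r) + w (C s) else v x)" for x
      using N(2) by (simp add: v2 C vw)
    have M1: "merge_val \<phi> (merge R k) ?V1 l a =
        (if merge R k a r \<or> merge R k a s then ?V1 r + ?V1 s else ?V1 a)"
      using none unfolding v2[of "merge R k"] by simp
    have M2: "merge_val \<phi> (merge R l) ?V2 k a =
        (if merge R l a p \<or> merge R l a q then ?V2 p + ?V2 q else ?V2 a)"
      using none unfolding v1[of "merge R l"] by simp
    consider "C p = C r" "C p \<noteq> C s" "C q \<noteq> C r" "C q \<noteq> C s"
      | "C p \<noteq> C r" "C p = C s" "C q \<noteq> C r" "C q \<noteq> C s"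
      | "C p \<noteq> C r" "C p \<noteq> C s" "C q = C r" "C q \<noteq> C s"
      | "C p \<noteq> C r" "C p \<noteq> C s" "C q \<noteq> C r" "C q = C s"
      | "C p \<noteq> C r" "C p \<noteq> C s" "C q \<noteq> C r" "C q \<noteq> C s"
      using N by metis
    then show ?thesis unfolding M1 M2 using N(1,2)
      by cases (cases "C a = C p"; cases "C a = C q"; cases "C a = C r"; cases "C a = C s";
        simp add: V1 V2 m1 m2 C vw add_ac)+
  qed
qed

end

lemma T_check_planar_obj:
  assumes "planar_obj (n + 2) R v" and adm: "admissible n k"
  shows "planar_obj n (fst (T_check \<phi> n k (R, v))) (snd (T_check \<phi> n k (R, v)))"
proof -
  interpret planar_obj "n + 2" R v by fact
  note rel = T_check_rel[OF assms, where \<phi> = \<phi>] and val = T_check_val[OF assms, where \<phi> = \<phi>]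
  have k: "2 \<le> k" "k + 1 \<le> n + 2" "1 \<le> n" using adm by (auto simp: admissible_def)
  let ?R = "fst (T_check \<phi> n k (R, v))" and ?v = "snd (T_check \<phi> n k (R, v))"
  \<comment> \<open>the smallest and the largest representative of a glued region, avoiding \<open>k\<close>\<close>
  define lo hi where "lo i = (if i < k then i else i + 2)" and "hi i = (if i < k - 1 then i else i + 2)"
    for i
  have lo: "lo i \<noteq> k" "glue k (lo i) = i" and hi: "hi i \<noteq> k" "glue k (hi i) = i" for i
    using k(1) by (auto simp: glue_def lo_def hi_def)
  have lo_in: "lo i \<in> {1..n+2} \<longleftrightarrow> i \<in> {1..n}" for i
    using glue_range[OF adm lo(1)[of i]] lo(2)[of i] by simp
  have val': "?v i = merge_val \<phi> R v k (lo i)" for i using val[OF lo(1)[of i]] lo(2)[of i] by simp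
  have R: "?R i j \<longleftrightarrow> merge R k (lo i) (lo j)" for i j
    using rel[of "lo i" "lo j"] lo by simp
  have minr: "a \<in> {1..n+2} \<and> b \<in> {1..n+2}" if "merge R k a b" for a b
    using that inr unfolding merge_def by blast
  show ?thesis
  proof (unfold_locales, goal_cases)
    case (1 i j)
    then show ?case using minr[of "lo i" "lo j"] lo_in unfolding R by blast
  next
    case (2 i)
    then have "lo i \<notin> {1..n+2}" using lo_in by blast
    then show ?case using inr v_out by (auto simp: val' merge_val_def)
  next
    case (3 i)
    then have "lo i \<in> {1..n+2}" using lo_in by blast
    then show ?case using refl by (simp add: R merge_def)
  next
    case (4 i j)
    then show ?case using merge_sym unfolding R by blast
  next
    case (5 i j l)
    then show ?case using merge_trans unfolding R by blast
  next
    case (6 i j)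
    then have "even (lo i) \<longleftrightarrow> even (lo j)" using merge_parity[OF k(1)] unfolding R by blast
    then show ?case by (simp add: lo_def split: if_splits)
  next
    case (7 a b c d)
    have mono: "lo x \<le> lo y" if "x \<le> y" for x y using that by (simp add: lo_def)
    show ?case using 7(4,5) lo(1) mono[OF 7(1)] mono[OF 7(2)] mono[OF 7(3)] unfolding R
      by (intro merge_noncrossing[of "lo a" "lo b" "lo c" "lo d"])
  next
    case (8 a b)
    have "merge R k (hi a + 1) (lo b - 1)"
    proof (rule merge_nested)
      show "merge R k (hi a) (lo b)" using 8(1) rel[OF hi(1)[of a] lo(1)[of b]] by (simp add: hi lo)
      show "hi a < lo b" using 8(2) by (auto simp: lo_def hi_def)
      show "hi a \<noteq> k - 1" "lo b \<noteq> k + 1" using k(1) by (auto simp: lo_def hi_def)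
      fix c assume c: "c \<noteq> k" "hi a < c" "c < lo b"
      then have "a < glue k c" "glue k c < b"
        using 8(2) k(1) by (auto simp: glue_def lo_def hi_def split: if_splits)
      then have "\<not> ?R a (glue k c)" using 8(3) by blast
      then show "\<not> merge R k (hi a) c" using rel[OF hi(1)[of a] c(1)] by (simp add: hi)
    qed (use k hi(1) lo(1) in auto)
    moreover have "glue k (hi a + 1) = a + 1" "hi a + 1 \<noteq> k" using k(1) by (auto simp: glue_def hi_def)
    moreover have "glue k (lo b - 1) = b - 1" "lo b - 1 \<noteq> k"
      using k(1) 8(2) by (auto simp: glue_def lo_def)
    ultimately show ?case using rel[of "hi a + 1" "lo b - 1"] by simp
  next
    case (9 i j)
    then show ?case using merge_val_const[of k "lo i" "lo j" \<phi>] by (simp add: val' R)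
  qed
qed

section \<open>The tangle relations\<close>

lemma obj_eqI:
  assumes "\<And>i j. fst X i j = fst Y i j" "\<And>i. snd X i = snd Y i"
  shows "X = (Y :: 'm pobj)"
  using assms by (intro prod_eqI ext) auto

lemma T_hat_in_obj_set:
  assumes "admissible n k" "X \<in> obj_set n"
  shows "T_hat n k X \<in> obj_set (n + 2)"
proof -
  obtain R v where X: "X = (R, v)" by fastforce
  have "1 \<le> n" "1 \<le> n + 2" using assms(1) by (auto simp: admissible_def)
  then show ?thesis using T_hat_planar_obj[of n R v k] assms
    obj_set_iff[of n R v] obj_set_iff[of "n + 2" "fst (T_hat n k X)" "snd (T_hat n k X)"] X by simp
qed

lemma T_check_in_obj_set:
  assumes "admissible n k" "X \<in> obj_set (n + 2)"
  shows "T_check \<phi> n k X \<in> obj_set n"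
proof -
  obtain R v where X: "X = (R, v)" by fastforce
  have "1 \<le> n" "1 \<le> n + 2" using assms(1) by (auto simp: admissible_def)
  then show ?thesis using T_check_planar_obj[of n R v k \<phi>] assms
    obj_set_iff[of "n + 2" R v] obj_set_iff[of n "fst (T_check \<phi> n k X)" "snd (T_check \<phi> n k X)"] X by simp
qed

lemma obj_setD: "X \<in> obj_set n \<Longrightarrow> 1 \<le> n \<Longrightarrow> planar_obj n (fst X) (snd X)"
  by (metis obj_set_iff prod.collapse)

lemma T_hat_apply:
  assumes "X \<in> obj_set n" "admissible n k"
  shows "fst (T_hat n k X) a b \<longleftrightarrow>
      (a = k \<and> b = k) \<or> (a \<noteq> k \<and> b \<noteq> k \<and> fst X (glue k a) (glue k b))"
    and "snd (T_hat n k X) a = (if a = k then 0 else snd X (glue k a))"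
  using T_hat_simps[of n "fst X" "snd X" k] obj_setD[OF assms(1)] assms(2)
  by (auto simp: admissible_def)

lemma T_check_apply:
  assumes "X \<in> obj_set (n + 2)" "admissible n k" "a \<noteq> k"
  shows "b \<noteq> k \<Longrightarrow> fst (T_check \<phi> n k X) (glue k a) (glue k b) \<longleftrightarrow> merge (fst X) k a b"
    and "snd (T_check \<phi> n k X) (glue k a) = merge_val \<phi> (fst X) (snd X) k a"
  using T_check_rel[of n "fst X" "snd X" k a b \<phi>] T_check_val[of n "fst X" "snd X" k a \<phi>]
    obj_setD[OF assms(1)] assms(2,3) by auto

text \<open>Closing next to a freshly created arc straightens it: the new region has value \<open>0\<close> and is related to
  nothing, so uniting it with its neighbour changes nothing.\<close>

lemma T_check_T_hat_cancel:
  assumes X: "X \<in> obj_set n" and adm: "admissible n k" "admissible n j" and j: "j = k + 1 \<or> j + 1 = k"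
  shows "T_check \<phi> n j (T_hat n k X) = X"
proof -
  interpret planar_obj n "fst X" "snd X" using obj_setD[OF X] adm by (simp add: admissible_def)
  have k: "2 \<le> k" "2 \<le> j" using adm by (auto simp: admissible_def)
  \<comment> \<open>representatives avoiding both removed regions, on which \<open>glue j\<close> and \<open>glue k\<close> agree\<close>
  define lo where "lo i = (if i < k \<and> i < j then i else i + 2)" for i
  have lo: "lo i \<noteq> j" "lo i \<noteq> k" "glue j (lo i) = i" "glue k (lo i) = i" for i
    using j by (auto simp: lo_def glue_def)
  note Y = T_hat_in_obj_set[OF adm(1) X] and S = T_hat_apply[OF X adm(1)]
  have jk: "(j - 1 = k \<and> j + 1 \<noteq> k \<and> glue k (j + 1) = k) \<or> (j + 1 = k \<and> j - 1 \<noteq> k \<and> glue k (j - 1) = j - 1)"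
    using j k by (auto simp: glue_def)
  show ?thesis
  proof (rule obj_eqI)
    fix a b
    have "merge (fst (T_hat n k X)) j (lo a) (lo b) \<longleftrightarrow> fst X a b"
      using jk lo by (auto simp: merge_def S)
    then show "fst (T_check \<phi> n j (T_hat n k X)) a b = fst X a b"
      using T_check_apply(1)[OF Y adm(2) lo(1)[of a] lo(1)[of b]] lo(3) by simp
    have "merge_val \<phi> (fst (T_hat n k X)) (snd (T_hat n k X)) j (lo a) = snd X a"
      using jk lo const[of a k] const[of a "j - 1"] by (auto simp: merge_val_def S)
    then show "snd (T_check \<phi> n j (T_hat n k X)) a = snd X a"
      using T_check_apply(2)[OF Y adm(2) lo(1)[of a]] lo(3) by simp
  qed
qed

lemma glue_eq_removed:
  assumes "k + 2 \<le> l" "2 \<le> k"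
  shows "a \<noteq> l \<Longrightarrow> glue l a = k \<longleftrightarrow> a = k" and "a \<noteq> k \<Longrightarrow> glue k a = l - 2 \<longleftrightarrow> a = l"
  using assms by (auto simp: glue_def)

lemma T_hat_commute:
  assumes X: "X \<in> obj_set n" and l: "k + 2 \<le> l"
    and adm: "admissible (n + 2) l" "admissible n k" "admissible (n + 2) k" "admissible n (l - 2)"
  shows "T_hat (n + 2) l (T_hat n k X) = T_hat (n + 2) k (T_hat n (l - 2) X)"
proof -
  have k: "2 \<le> k" using adm by (auto simp: admissible_def)
  note S = T_hat_apply[OF T_hat_in_obj_set[OF adm(2) X] adm(1)] T_hat_apply[OF X adm(2)]
    T_hat_apply[OF T_hat_in_obj_set[OF adm(4) X] adm(3)] T_hat_apply[OF X adm(4)]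
  show ?thesis
  proof (rule obj_eqI)
    fix i j
    show "fst (T_hat (n + 2) l (T_hat n k X)) i j = fst (T_hat (n + 2) k (T_hat n (l - 2) X)) i j"
      unfolding S using glue_eq_removed[OF l k] glue_commute[OF l] l
      by (cases "i = k"; cases "i = l"; cases "j = k"; cases "j = l") simp_all
    show "snd (T_hat (n + 2) l (T_hat n k X)) i = snd (T_hat (n + 2) k (T_hat n (l - 2) X)) i"
      unfolding S using glue_eq_removed[OF l k] glue_commute[OF l] l
      by (cases "i = k"; cases "i = l") simp_all
  qed
qed

lemma glue_glue_surj:
  assumes "k + 2 \<le> l" shows "\<exists>a. a \<noteq> k \<and> a \<noteq> l \<and> glue (l - 2) (glue k a) = i"
proof -
  obtain b where b: "b \<noteq> l - 2" "glue (l - 2) b = i" using glue_surj by blast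
  obtain a where a: "a \<noteq> k" "glue k a = b" using glue_surj by blast
  have "a \<noteq> l" using a b assms by (auto simp: glue_def)
  then show ?thesis using a b by blast
qed

text \<open>Near one removed region the other gluing is a bijection; these equations rewrite the neighbours of
  the second arc into the form in which \<open>T_check_apply\<close> evaluates them.\<close>

lemma glue_neighbours:
  assumes "k + 2 \<le> l" "2 \<le> k"
  shows "l - 2 - 1 = glue k (l - 1)" "l - 2 + 1 = glue k (l + 1)" "l - 2 = glue k l"
    "k - 1 = glue l (k - 1)" "k + 1 = glue l (k + 1)" "k = glue l k"
    "l - 1 \<noteq> k" "l + 1 \<noteq> k" "l \<noteq> k" "k - 1 \<noteq> l" "k + 1 \<noteq> l"
  using assms by (auto simp: glue_def)

lemma T_check_commute:
  assumes X: "X \<in> obj_set (n + 2)" and l: "k + 2 \<le> l"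
    and adm: "admissible (n - 2) (l - 2)" "admissible n k" "admissible (n - 2) k" "admissible n l"
  shows "T_check \<phi> (n - 2) (l - 2) (T_check \<phi> n k X) = T_check \<phi> (n - 2) k (T_check \<phi> n l X)"
proof -
  have k: "2 \<le> k" "l + 1 \<le> n + 2" "n - 2 + 2 = n" using adm by (auto simp: admissible_def)
  interpret planar_obj "n + 2" "fst X" "snd X" using obj_setD[OF X] by simp
  note pm = glue_neighbours[OF l k(1)]
  have Y: "T_check \<phi> n k X \<in> obj_set (n - 2 + 2)" "T_check \<phi> n l X \<in> obj_set (n - 2 + 2)"
    using T_check_in_obj_set[OF adm(2) X] T_check_in_obj_set[OF adm(4) X] k(3) by simp_all
  let ?L = "T_check \<phi> (n - 2) (l - 2) (T_check \<phi> n k X)"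
  let ?K = "T_check \<phi> (n - 2) k (T_check \<phi> n l X)"
  have rel: "fst ?L (glue (l - 2) (glue k a)) (glue (l - 2) (glue k b)) \<longleftrightarrow>
      fst ?K (glue (l - 2) (glue k a)) (glue (l - 2) (glue k b))"
    and val: "snd ?L (glue (l - 2) (glue k a)) = snd ?K (glue (l - 2) (glue k a))"
    if a: "a \<noteq> k" "a \<noteq> l" and b: "b \<noteq> k" "b \<noteq> l" for a b
  proof -
    have g: "glue k x \<noteq> l - 2" "glue l x \<noteq> k" if "x \<noteq> k" "x \<noteq> l" for x
      using glue_eq_removed[OF l k(1)] that by auto
    have L: "merge (fst (T_check \<phi> n k X)) (l - 2) (glue k x) (glue k y) \<longleftrightarrow> merge (merge (fst X) k) l x y"
      "merge_val \<phi> (fst (T_check \<phi> n k X)) (snd (T_check \<phi> n k X)) (l - 2) (glue k x) =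
        merge_val \<phi> (merge (fst X) k) (merge_val \<phi> (fst X) (snd X) k) l x"
      if "x \<noteq> k" "y \<noteq> k" for x y
      unfolding merge_def[of _ "l - 2"] merge_def[of _ l] merge_val_def[of _ _ _ "l - 2"]
        merge_val_def[of _ _ _ l] pm(1,2)
      unfolding pm(3)
      by (simp_all only: T_check_apply[OF X adm(2)] that pm(7-9) not_False_eq_True)
    have K: "merge (fst (T_check \<phi> n l X)) k (glue l x) (glue l y) \<longleftrightarrow> merge (merge (fst X) l) k x y"
      "merge_val \<phi> (fst (T_check \<phi> n l X)) (snd (T_check \<phi> n l X)) k (glue l x) =
        merge_val \<phi> (merge (fst X) l) (merge_val \<phi> (fst X) (snd X) l) k x"
      if "x \<noteq> l" "y \<noteq> l" for x y
    proof -
      note c = T_check_apply[OF X adm(4), where \<phi> = \<phi>]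
      have e: "fst (T_check \<phi> n l X) (glue l u) (k - 1) = merge (fst X) l u (k - 1)"
        "fst (T_check \<phi> n l X) (glue l u) (k + 1) = merge (fst X) l u (k + 1)"
        "fst (T_check \<phi> n l X) (k - 1) (glue l u) = merge (fst X) l (k - 1) u"
        "fst (T_check \<phi> n l X) (k + 1) (glue l u) = merge (fst X) l (k + 1) u"
        if "u \<noteq> l" for u
        using c(1)[of u "k - 1"] c(1)[of u "k + 1"] c(1)[of "k - 1" u] c(1)[of "k + 1" u] that pm
        by simp_all
      have f: "fst (T_check \<phi> n l X) (k - 1) (k + 1) = merge (fst X) l (k - 1) (k + 1)"
        using e(3)[of "k + 1"] pm by simp
      have h: "snd (T_check \<phi> n l X) (k - 1) = merge_val \<phi> (fst X) (snd X) l (k - 1)"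
        "snd (T_check \<phi> n l X) (k + 1) = merge_val \<phi> (fst X) (snd X) l (k + 1)"
        "snd (T_check \<phi> n l X) k = merge_val \<phi> (fst X) (snd X) l k"
        using c(2)[of "k - 1"] c(2)[of "k + 1"] c(2)[of k] pm by simp_all
      show "merge (fst (T_check \<phi> n l X)) k (glue l x) (glue l y) \<longleftrightarrow> merge (merge (fst X) l) k x y"
        unfolding merge_def[of _ k] using e that c(1) by simp
      show "merge_val \<phi> (fst (T_check \<phi> n l X)) (snd (T_check \<phi> n l X)) k (glue l x) =
        merge_val \<phi> (merge (fst X) l) (merge_val \<phi> (fst X) (snd X) l) k x"
        unfolding merge_val_def[of _ _ _ k] using e f h that c(2) by simp
    qed
    show "fst ?L (glue (l - 2) (glue k a)) (glue (l - 2) (glue k b)) \<longleftrightarrow>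
      fst ?K (glue (l - 2) (glue k a)) (glue (l - 2) (glue k b))"
      using T_check_apply(1)[OF Y(1) adm(1) g(1)[OF a] g(1)[OF b]]
        T_check_apply(1)[OF Y(2) adm(3) g(2)[OF a] g(2)[OF b]]
        L(1)[OF a(1) b(1)] K(1)[OF a(2) b(2)] merge_commute[of k l a b]
      by (simp add: glue_commute[OF l a] glue_commute[OF l b])
    show "snd ?L (glue (l - 2) (glue k a)) = snd ?K (glue (l - 2) (glue k a))"
      using T_check_apply(2)[OF Y(1) adm(1) g(1)[OF a]] T_check_apply(2)[OF Y(2) adm(3) g(2)[OF a]]
        L(2)[OF a(1) b(1)] K(2)[OF a(2) b(2)] merge_val_commute[OF k(1) l k(2) a, of \<phi>]
      by (simp add: glue_commute[OF l a])
  qed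
  show ?thesis
  proof (rule obj_eqI)
    fix i j
    obtain a b where "a \<noteq> k" "a \<noteq> l" "glue (l - 2) (glue k a) = i"
        "b \<noteq> k" "b \<noteq> l" "glue (l - 2) (glue k b) = j"
      using glue_glue_surj[OF l] by metis
    then show "fst ?L i j = fst ?K i j" "snd ?L i = snd ?K i" using rel[of a b] val[of a b] by auto
  qed
qed

lemma T_check_left_of_T_hat:
  assumes X: "X \<in> obj_set n" and l: "k + 2 \<le> l"
    and adm: "admissible (n - 2) (l - 2)" "admissible (n - 2) k" "admissible n k" "admissible n l"
  shows "T_hat (n - 2) (l - 2) (T_check \<phi> (n - 2) k X) = T_check \<phi> n k (T_hat n l X)"
proof -
  have k: "2 \<le> k" "n - 2 + 2 = n" using adm by (auto simp: admissible_def)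
  have X': "X \<in> obj_set (n - 2 + 2)" using X k by simp
  note pm = glue_neighbours[OF l k(1)]
  note H = T_hat_apply[OF X adm(4)] and C = T_check_apply[OF X' adm(2), where \<phi> = \<phi>]
  note L = T_hat_apply[OF T_check_in_obj_set[OF adm(2) X', of \<phi>] adm(1)]
    and K = T_check_apply[OF T_hat_in_obj_set[OF adm(4) X] adm(3), where \<phi> = \<phi>]
  have g: "glue l x \<noteq> k" if "x \<noteq> k" "x \<noteq> l" for x using glue_eq_removed[OF l k(1)] that by auto
  have gk: "glue k x = l - 2 \<longleftrightarrow> x = l" if "x \<noteq> k" for x using glue_eq_removed[OF l k(1)] that by auto
  have fx: "glue l (k - 1) = k - 1" "glue l (k + 1) = k + 1" "glue l k = k" using pm by simp_all
  show ?thesis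
  proof (rule obj_eqI)
    fix i j
    obtain a b where a: "a \<noteq> k" "glue k a = i" and b: "b \<noteq> k" "glue k b = j" using glue_surj by metis
    have "fst (T_hat (n - 2) (l - 2) (T_check \<phi> (n - 2) k X)) i j \<longleftrightarrow>
        (a = l \<and> b = l) \<or> (a \<noteq> l \<and> b \<noteq> l \<and> merge (fst X) k (glue l a) (glue l b))"
      unfolding L using C(1)[OF g g, of a b] gk[OF a(1)] gk[OF b(1)] a b
      by (auto simp: glue_commute[OF l])
    also have "\<dots> \<longleftrightarrow> merge (fst (T_hat n l X)) k a b"
      unfolding merge_def H fx using pm by auto
    finally show "fst (T_hat (n - 2) (l - 2) (T_check \<phi> (n - 2) k X)) i j =
        fst (T_check \<phi> n k (T_hat n l X)) i j" using K(1)[OF a(1) b(1)] a b by simp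
    have "snd (T_hat (n - 2) (l - 2) (T_check \<phi> (n - 2) k X)) i =
        (if a = l then 0 else merge_val \<phi> (fst X) (snd X) k (glue l a))"
      unfolding L using C(2)[OF g, of a] gk[OF a(1)] a by (auto simp: glue_commute[OF l])
    also have "\<dots> = merge_val \<phi> (fst (T_hat n l X)) (snd (T_hat n l X)) k a"
      unfolding merge_val_def H fx using pm by auto
    finally show "snd (T_hat (n - 2) (l - 2) (T_check \<phi> (n - 2) k X)) i =
        snd (T_check \<phi> n k (T_hat n l X)) i" using K(2)[OF a(1)] a by simp
  qed
qed

lemma T_check_right_of_T_hat:
  assumes X: "X \<in> obj_set n" and l: "k + 2 \<le> l"
    and adm: "admissible n l" "admissible n k" "admissible (n - 2) k" "admissible (n - 2) (l - 2)"
  shows "T_check \<phi> n l (T_hat n k X) = T_hat (n - 2) k (T_check \<phi> (n - 2) (l - 2) X)"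
proof -
  have k: "2 \<le> k" "n - 2 + 2 = n" using adm by (auto simp: admissible_def)
  have X': "X \<in> obj_set (n - 2 + 2)" using X k by simp
  note pm = glue_neighbours[OF l k(1)]
  note H = T_hat_apply[OF X adm(2)] and C = T_check_apply[OF X' adm(4), where \<phi> = \<phi>]
  note L = T_hat_apply[OF T_check_in_obj_set[OF adm(4) X', of \<phi>] adm(3)]
    and K = T_check_apply[OF T_hat_in_obj_set[OF adm(2) X] adm(1), where \<phi> = \<phi>]
  have g: "glue k x \<noteq> l - 2" if "x \<noteq> k" "x \<noteq> l" for x using glue_eq_removed[OF l k(1)] that by auto
  have gl: "glue l x = k \<longleftrightarrow> x = k" if "x \<noteq> l" for x using glue_eq_removed[OF l k(1)] that by auto
  have fx: "glue k (l - 1) = l - 2 - 1" "glue k (l + 1) = l - 2 + 1" "glue k l = l - 2" using pm by simp_all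
  show ?thesis
  proof (rule obj_eqI)
    fix i j
    obtain a b where a: "a \<noteq> l" "glue l a = i" and b: "b \<noteq> l" "glue l b = j" using glue_surj by metis
    have "fst (T_hat (n - 2) k (T_check \<phi> (n - 2) (l - 2) X)) i j \<longleftrightarrow>
        (a = k \<and> b = k) \<or> (a \<noteq> k \<and> b \<noteq> k \<and> merge (fst X) (l - 2) (glue k a) (glue k b))"
      unfolding L using C(1)[OF g g, of a b] gl[OF a(1)] gl[OF b(1)] a b
      by (auto simp: glue_commute[OF l])
    also have "\<dots> \<longleftrightarrow> merge (fst (T_hat n k X)) l a b"
      unfolding merge_def H fx using pm by auto
    finally show "fst (T_check \<phi> n l (T_hat n k X)) i j =
        fst (T_hat (n - 2) k (T_check \<phi> (n - 2) (l - 2) X)) i j" using K(1)[OF a(1) b(1)] a b by simp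
    have "snd (T_hat (n - 2) k (T_check \<phi> (n - 2) (l - 2) X)) i =
        (if a = k then 0 else merge_val \<phi> (fst X) (snd X) (l - 2) (glue k a))"
      unfolding L using C(2)[OF g, of a] gl[OF a(1)] a by (auto simp: glue_commute[OF l])
    also have "\<dots> = merge_val \<phi> (fst (T_hat n k X)) (snd (T_hat n k X)) l a"
      unfolding merge_val_def H fx using pm by auto
    finally show "snd (T_check \<phi> n l (T_hat n k X)) i =
        snd (T_hat (n - 2) k (T_check \<phi> (n - 2) (l - 2) X)) i" using K(2)[OF a(1)] a by simp
  qed
qed

section \<open>Functors on the presented category\<close>

lemma is_word_append: "is_word n p u \<Longrightarrow> is_word m n w \<Longrightarrow> is_word m p (u @ w)"
  by (induction rule: is_word.induct) (auto intro: is_word.intros)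

lemma word_cong_is_word: "word_cong m n u w \<Longrightarrow> is_word m n u \<and> is_word m n w"
proof (induction rule: word_cong.induct)
  case (wc_comp n p u u' m w w')
  show ?case using wc_comp is_word_append by blast
qed auto

definition wclass :: "nat \<Rightarrow> nat \<Rightarrow> tangle_gen list \<Rightarrow> tangle_gen list set" where
  "wclass m n w = word_rel m n `` {w}"

lemma wclass_iff: "u \<in> wclass m n w \<longleftrightarrow> word_cong m n w u"
  by (simp add: wclass_def word_rel_def)

lemma wclass_eq: "word_cong m n u w \<Longrightarrow> wclass m n u = wclass m n w"
  unfolding set_eq_iff wclass_iff by (blast intro: wc_trans wc_sym)

lemma Obj_presented: "Obj presented_cat = UNIV" by (simp add: presented_cat_def)

lemma Hom_presented: "f \<in> Hom presented_cat m n \<longleftrightarrow> (\<exists>w. is_word m n w \<and> f = wclass m n w)"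
  by (auto simp: presented_cat_def quotient_def wclass_def)

lemma Cmp_presented:
  assumes "is_word m n w" "is_word n p u"
  shows "Cmp presented_cat m n p (wclass n p u) (wclass m n w) = wclass m p (u @ w)"
proof -
  have "wclass m p (u' @ w') = wclass m p (u @ w)" if "w' \<in> wclass m n w" "u' \<in> wclass n p u" for u' w'
    using that unfolding wclass_iff by (intro wclass_eq wc_sym[OF wc_comp])
  then have "(\<Union>w'\<in>wclass m n w. \<Union>u'\<in>wclass n p u. wclass m p (u' @ w')) =
      (\<Union>w'\<in>wclass m n w. \<Union>u'\<in>wclass n p u. wclass m p (u @ w))"
    by (intro SUP_cong HOL.refl)
  moreover have "w \<in> wclass m n w" "u \<in> wclass n p u" using assms by (auto simp: wclass_iff intro: wc_refl)
  ultimately have "(\<Union>w'\<in>wclass m n w. \<Union>u'\<in>wclass n p u. wclass m p (u' @ w')) = wclass m p (u @ w)"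
    by blast
  then show ?thesis by (simp add: presented_cat_def wclass_def)
qed

lemma Idn_presented: "Idn presented_cat n = wclass n n []"
  by (simp add: presented_cat_def wclass_def)

lemma category_presented: "category presented_cat"
  unfolding category_def
proof (intro conjI ballI, goal_cases)
  case (1 a)
  then show ?case unfolding Idn_presented Hom_presented by (auto intro: is_word.intros)
next
  case (2 a b c f g)
  then show ?case unfolding Hom_presented using Cmp_presented is_word_append by metis
next
  case (3 a b f)
  then show ?case unfolding Hom_presented Idn_presented
    using Cmp_presented is_word.intros(1) by fastforce
next
  case (4 a b f)
  then show ?case unfolding Hom_presented Idn_presented
    using Cmp_presented is_word.intros(1) by fastforce
next
  case (5 a b c d f g h)
  then show ?case unfolding Hom_presented
    by (auto simp: Cmp_presented is_word_append)
qed

lemma category_PI: "category PI_cat"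
  unfolding category_def
proof (intro conjI ballI, goal_cases)
  case (1 a)
  show ?case by (simp add: PI_cat_def)
next
  case (2 a b c f g)
  then show ?case by (simp add: PI_cat_def compose_def PiE_iff)
next
  case (3 a b f)
  then show ?case by (auto simp: PI_cat_def compose_def intro!: ext elim: PiE_arb)
next
  case (4 a b f)
  then have f: "f \<in> a \<rightarrow>\<^sub>E b" by (simp add: PI_cat_def)
  have "compose a (\<lambda>x\<in>b. x) f x = f x" for x
    using PiE_mem[OF f, of x] PiE_arb[OF f, of x] by (cases "x \<in> a") (auto simp: compose_def)
  then show ?case by (auto simp: PI_cat_def)
next
  case (5 a b c d f g h)
  then have f: "f \<in> a \<rightarrow>\<^sub>E b" by (simp add: PI_cat_def)
  have "compose a (compose b h g) f x = compose a h (compose a g f) x" for x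
    using PiE_mem[OF f, of x] by (cases "x \<in> a") (auto simp: compose_def)
  then show ?case by (auto simp: PI_cat_def)
qed

fun gen_fun :: "('m \<Rightarrow> 'm) \<Rightarrow> tangle_gen \<Rightarrow> 'm pobj \<Rightarrow> 'm::lattice_ordered_additive_monoid pobj" where
  "gen_fun \<phi> (Hat n k) = T_hat n k"
| "gen_fun \<phi> (Check n k) = T_check \<phi> n k"

fun word_fun :: "('m \<Rightarrow> 'm) \<Rightarrow> tangle_gen list \<Rightarrow> 'm pobj \<Rightarrow> 'm::lattice_ordered_additive_monoid pobj" where
  "word_fun \<phi> [] = id"
| "word_fun \<phi> (x # w) = gen_fun \<phi> x \<circ> word_fun \<phi> w"

lemma word_fun_append: "word_fun \<phi> (u @ w) = word_fun \<phi> u \<circ> word_fun \<phi> w"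
  by (induction u) auto

lemma gen_fun_mem:
  "gen_ok x \<Longrightarrow> X \<in> obj_set (gen_src x + 1) \<Longrightarrow> gen_fun \<phi> x X \<in> obj_set (gen_tgt x + 1)"
  using T_hat_in_obj_set[of _ _ X] T_check_in_obj_set[of _ _ X \<phi>] by (cases x) (simp_all add: admissible_def)

lemma word_fun_mem: "is_word m n w \<Longrightarrow> X \<in> obj_set (m + 1) \<Longrightarrow> word_fun \<phi> w X \<in> obj_set (n + 1)"
proof (induction rule: is_word.induct)
  case (2 m n w x)
  then show ?case using gen_fun_mem[of x "word_fun \<phi> w X" \<phi>] by simp
qed simp

inductive_cases is_word_ConsE: "is_word m n (x # w)"

lemma is_word_NilD: "is_word m n [] \<Longrightarrow> m = n"
  by (auto elim: is_word.cases)

lemma is_word_pairD: "is_word m n [x, y] \<Longrightarrow> gen_ok x \<and> gen_ok y \<and> gen_src y = m"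
  by (auto elim!: is_word_ConsE dest: is_word_NilD)

lemma relation_sound:
  assumes "tangle_relation u w" "is_word m n u" "is_word m n w" "X \<in> obj_set (m + 1)"
  shows "word_fun \<phi> u X = word_fun \<phi> w X"
  using assms
proof (induction rule: tangle_relation.induct)
  case (rel1a n' k)
  then have "admissible n' k" "admissible n' (k + 1)" "X \<in> obj_set n'"
    using is_word_pairD[OF rel1a(1)] by (auto simp: admissible_def)
  then show ?case using T_check_T_hat_cancel[of X n' k "k + 1" \<phi>] by simp
next
  case (rel1b n' k)
  then have "admissible n' k" "admissible n' (k - 1)" "X \<in> obj_set n'" "k - 1 + 1 = k"
    using is_word_pairD[OF rel1b(1)] by (auto simp: admissible_def)
  then show ?case using T_check_T_hat_cancel[of X n' k "k - 1" \<phi>] by simp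
next
  case (rel2 l k n')
  then have "X \<in> obj_set n'" using is_word_pairD[OF rel2(2)] by (auto simp: admissible_def)
  then show ?case using T_hat_commute[of X n' k l] is_word_pairD[OF rel2(2)] is_word_pairD[OF rel2(3)] rel2(1) by simp
next
  case (rel3 l k n')
  then have "X \<in> obj_set (n' + 2)" using is_word_pairD[OF rel3(2)] by auto
  then show ?case using T_check_commute[of X n' k l \<phi>] is_word_pairD[OF rel3(2)] is_word_pairD[OF rel3(3)] rel3(1) by simp
next
  case (rel4 l k n')
  then have "X \<in> obj_set n'" using is_word_pairD[OF rel4(3)] by (auto simp: admissible_def)
  then show ?case using T_check_left_of_T_hat[of X n' k l \<phi>] is_word_pairD[OF rel4(2)] is_word_pairD[OF rel4(3)] rel4(1) by simp
next
  case (rel5 l k n')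
  then have "X \<in> obj_set n'" using is_word_pairD[OF rel5(2)] by (auto simp: admissible_def)
  then show ?case using T_check_right_of_T_hat[of X n' k l \<phi>] is_word_pairD[OF rel5(2)] is_word_pairD[OF rel5(3)] rel5(1) by simp
qed

lemma word_cong_sound:
  "word_cong m n u w \<Longrightarrow> X \<in> obj_set (m + 1) \<Longrightarrow> word_fun \<phi> u X = word_fun \<phi> w X"
proof (induction arbitrary: X rule: word_cong.induct)
  case (wc_rel u w m n)
  then show ?case using relation_sound by blast
next
  case (wc_comp n p u u' m w w')
  have "word_fun \<phi> w X \<in> obj_set (n + 1)"
    using word_fun_mem[of m n w X \<phi>] word_cong_is_word[OF wc_comp(2)] wc_comp.prems by blast
  then show ?case using wc_comp by (simp add: word_fun_append)
qed simp_all

text \<open>The choice of a representative is harmless by \<open>word_cong_sound\<close>; \<open>restrict\<close> produces the extensional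
  functions that are the morphisms of the target category.\<close>

definition eval_fun ::
    "('m \<Rightarrow> 'm) \<Rightarrow> nat \<Rightarrow> nat \<Rightarrow> tangle_gen list set \<Rightarrow> 'm pobj \<Rightarrow> 'm::lattice_ordered_additive_monoid pobj" where
  "eval_fun \<phi> m n f = restrict (word_fun \<phi> (SOME w. w \<in> f)) (obj_set (m + 1))"

lemma eval_fun_wclass:
  assumes "is_word m n w"
  shows "eval_fun \<phi> m n (wclass m n w) = restrict (word_fun \<phi> w) (obj_set (m + 1))"
proof -
  have "w \<in> wclass m n w" using assms by (simp add: wclass_iff wc_refl)
  then have "(SOME w'. w' \<in> wclass m n w) \<in> wclass m n w" by (rule someI)
  then have "word_cong m n w (SOME w'. w' \<in> wclass m n w)" by (simp add: wclass_iff)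
  from word_cong_sound[OF this, of _ \<phi>] show ?thesis
    unfolding eval_fun_def by (intro restrict_ext) simp
qed

lemma is_word_single: "gen_ok x \<Longrightarrow> is_word (gen_src x) (gen_tgt x) [x]"
  using is_word.intros(2)[OF is_word.intros(1)] by simp

lemma eval_fun_extends: "extends_generators \<phi> presented_cat p_hat p_check (eval_fun \<phi>)"
  unfolding extends_generators_def
proof (intro conjI allI impI)
  show "is_functor presented_cat PI_cat (\<lambda>n. obj_set (n + 1)) (eval_fun \<phi>)"
    unfolding is_functor_def
  proof (intro conjI ballI, goal_cases)
    case 1 show ?case by (rule category_presented)
  next
    case 2 show ?case by (rule category_PI)
  next
    case (3 a) show ?case by (auto simp: PI_cat_def)
  next
    case (4 a b f)
    then obtain w where w: "is_word a b w" "f = wclass a b w" unfolding Hom_presented by blast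
    then show ?case using word_fun_mem[OF w(1), of _ \<phi>]
      by (auto simp: eval_fun_wclass PI_cat_def)
  next
    case (5 a)
    show ?case unfolding Idn_presented eval_fun_wclass[OF is_word.intros(1)]
      by (auto simp: PI_cat_def)
  next
    case (6 a b c f g)
    then obtain w u where w: "is_word a b w" "f = wclass a b w" and u: "is_word b c u" "g = wclass b c u"
      unfolding Hom_presented by blast
    show ?case unfolding w(2) u(2) Cmp_presented[OF w(1) u(1)]
      eval_fun_wclass[OF w(1)] eval_fun_wclass[OF u(1)] eval_fun_wclass[OF is_word_append[OF u(1) w(1)]]
      using word_fun_mem[OF w(1), of _ \<phi>] by (auto simp: PI_cat_def word_fun_append compose_def)
  qed
next
  fix n k assume "admissible n k"
  then show "eval_fun \<phi> (n - 1) (n + 1) (p_hat n k) = restrict (T_hat n k) (obj_set n)"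
    "eval_fun \<phi> (n + 1) (n - 1) (p_check n k) = restrict (T_check \<phi> n k) (obj_set (n + 2))"
    using is_word_single[of "Hat n k"] is_word_single[of "Check n k"] unfolding p_hat_def p_check_def wclass_def[symmetric]
    by (simp_all add: eval_fun_wclass admissible_def)
qed

lemma presented_unique:
  assumes "extends_generators \<phi> presented_cat p_hat p_check F"
    "extends_generators \<phi> presented_cat p_hat p_check F'"
    "is_word m n w"
  shows "F m n (wclass m n w) = F' m n (wclass m n w)"
  using assms(3)
proof (induction rule: is_word.induct)
  case (1 m)
  then show ?case using assms(1,2) unfolding extends_generators_def is_functor_def
    by (simp add: Idn_presented[symmetric] presented_cat_def)
next
  case (2 m n w x)
  have x: "is_word n (gen_tgt x) [x]" using is_word_single 2 by metis
  have gen: "F n (gen_tgt x) (wclass n (gen_tgt x) [x]) = F' n (gen_tgt x) (wclass n (gen_tgt x) [x])"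
    using assms(1,2) "2.hyps"(2,3) unfolding extends_generators_def p_hat_def p_check_def wclass_def by (cases x) auto
  have hom: "wclass m n w \<in> Hom presented_cat m n"
    "wclass n (gen_tgt x) [x] \<in> Hom presented_cat n (gen_tgt x)"
    using Hom_presented "2.hyps"(1) x by blast+
  have comp: "G m (gen_tgt x) (wclass m (gen_tgt x) (x # w)) = Cmp PI_cat (obj_set (m + 1)) (obj_set (n + 1))
      (obj_set (gen_tgt x + 1)) (G n (gen_tgt x) (wclass n (gen_tgt x) [x])) (G m n (wclass m n w))"
    if "extends_generators \<phi> presented_cat p_hat p_check G" for G
  proof -
    have "G m (gen_tgt x) (Cmp presented_cat m n (gen_tgt x) (wclass n (gen_tgt x) [x]) (wclass m n w)) =
      Cmp PI_cat (obj_set (m + 1)) (obj_set (n + 1))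
      (obj_set (gen_tgt x + 1)) (G n (gen_tgt x) (wclass n (gen_tgt x) [x])) (G m n (wclass m n w))"
      using that hom unfolding extends_generators_def is_functor_def Obj_presented by simp
    then show ?thesis using Cmp_presented[OF "2.hyps"(1) x] by simp
  qed
  show ?case unfolding comp[OF assms(1)] comp[OF assms(2)] gen "2.IH" ..
qed

text \<open>A presentation is an isomorphism \<open>J\<close> from the presented category that fixes objects and generators.
  Existence is composition with the inverse of \<open>J\<close>; for uniqueness, precomposing with \<open>J\<close> reduces to
  the presented category.\<close>

lemma presentation_defines_functor:
  assumes "has_tangle_presentation C h c"
  shows "defines_functor \<phi> C h c"
proof -
  from assms obtain J where ObjC: "Obj C = UNIV" and J: "is_functor presented_cat C id J"
    and bij: "\<And>m n. bij_betw (J m n) (Hom presented_cat m n) (Hom C m n)"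
    and gens: "\<And>n k. admissible n k \<Longrightarrow>
        J (n - 1) (n + 1) (p_hat n k) = h n k \<and> J (n + 1) (n - 1) (p_check n k) = c n k"
    unfolding has_tangle_presentation_def by blast
  define K where "K m n = inv_into (Hom presented_cat m n) (J m n)" for m n
  have KJ: "K m n (J m n f) = f" if "f \<in> Hom presented_cat m n" for m n f
    using that bij unfolding K_def by (metis bij_betw_inv_into_left)
  have JK: "J m n (K m n t) = t" and K: "K m n t \<in> Hom presented_cat m n" if "t \<in> Hom C m n" for m n t
    using that bij[of m n] unfolding K_def
    by (auto simp: bij_betw_def f_inv_into_f inv_into_into)
  have Jid: "J a a (Idn presented_cat a) = Idn C a" for a
    using J unfolding is_functor_def Obj_presented by simp
  have Jcmp: "J a d (Cmp presented_cat a b d g f) = Cmp C a b d (J b d g) (J a b f)"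
    if "f \<in> Hom presented_cat a b" "g \<in> Hom presented_cat b d" for a b d f g
    using J that unfolding is_functor_def Obj_presented by simp
  have Jhom: "J a b f \<in> Hom C a b" if "f \<in> Hom presented_cat a b" for a b f
    using J that unfolding is_functor_def Obj_presented by simp
  have catC: "category C" using J unfolding is_functor_def by blast
  have cat: "Idn presented_cat a \<in> Hom presented_cat a a"
    "\<lbrakk>f \<in> Hom presented_cat a b; g \<in> Hom presented_cat b d\<rbrakk> \<Longrightarrow>
      Cmp presented_cat a b d g f \<in> Hom presented_cat a d" for a b d f g
    using category_presented unfolding category_def Obj_presented by simp_all
  have phom: "p_hat n k \<in> Hom presented_cat (n - 1) (n + 1)"
    "p_check n k \<in> Hom presented_cat (n + 1) (n - 1)" if "admissible n k" for n k
    unfolding p_hat_def p_check_def wclass_def[symmetric] Hom_presented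
    using that is_word_single[of "Hat n k"] is_word_single[of "Check n k"] by auto
  define F where "F m n t = eval_fun \<phi> m n (K m n t)" for m n t
  have E: "is_functor presented_cat PI_cat (\<lambda>n. obj_set (n + 1)) (eval_fun \<phi>)"
    using eval_fun_extends unfolding extends_generators_def by blast
  have "extends_generators \<phi> C h c F"
    unfolding extends_generators_def
  proof (intro conjI allI impI)
    show "is_functor C PI_cat (\<lambda>n. obj_set (n + 1)) F"
      unfolding is_functor_def
    proof (intro conjI ballI, goal_cases)
      case 1 show ?case by (rule catC)
    next
      case 2 show ?case by (rule category_PI)
    next
      case (3 a) show ?case by (auto simp: PI_cat_def)
    next
      case (4 a b f)
      then show ?case using E K unfolding F_def is_functor_def Obj_presented by blast
    next
      case (5 a)
      have "K a a (Idn C a) = Idn presented_cat a" using KJ[OF cat(1)] Jid by metis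
      then show ?case using E unfolding F_def is_functor_def Obj_presented by simp
    next
      case (6 a b d f g)
      have "K a d (Cmp C a b d g f) = Cmp presented_cat a b d (K b d g) (K a b f)"
        using KJ[OF cat(2)[OF K[OF 6(4)] K[OF 6(5)]]] Jcmp[OF K[OF 6(4)] K[OF 6(5)]]
          JK[OF 6(4)] JK[OF 6(5)] by simp
      then show ?case using E K[OF 6(4)] K[OF 6(5)] unfolding F_def is_functor_def Obj_presented by simp
    qed
  next
    fix n k assume a: "admissible n k"
    have "K (n - 1) (n + 1) (h n k) = p_hat n k" "K (n + 1) (n - 1) (c n k) = p_check n k"
      using gens[OF a] KJ phom[OF a] by metis+
    then show "F (n - 1) (n + 1) (h n k) = restrict (T_hat n k) (obj_set n)"
      "F (n + 1) (n - 1) (c n k) = restrict (T_check \<phi> n k) (obj_set (n + 2))"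
      using eval_fun_extends[of \<phi>] a unfolding extends_generators_def F_def by simp_all
  qed
  moreover have "G m n t = G' m n t"
    if G: "extends_generators \<phi> C h c G" "extends_generators \<phi> C h c G'" and t: "t \<in> Hom C m n" for G G' m n t
  proof -
    have ext: "extends_generators \<phi> presented_cat p_hat p_check (\<lambda>m n f. H m n (J m n f))"
      if "extends_generators \<phi> C h c H" for H
    proof -
      have H: "is_functor C PI_cat (\<lambda>n. obj_set (n + 1)) H" using that unfolding extends_generators_def by blast
      have "is_functor presented_cat PI_cat (\<lambda>n. obj_set (n + 1)) (\<lambda>m n f. H m n (J m n f))"
        using H Jhom Jcmp Jid category_presented unfolding is_functor_def Obj_presented ObjC by simp
      then show ?thesis using that gens unfolding extends_generators_def by simp
    qed
    obtain w where "is_word m n w" "K m n t = wclass m n w" using K[OF t] unfolding Hom_presented by blast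
    then have "G m n (J m n (K m n t)) = G' m n (J m n (K m n t))"
      using presented_unique[OF ext[OF G(1)] ext[OF G(2)]] by simp
    then show ?thesis using JK[OF t] by simp
  qed
  ultimately show ?thesis unfolding defines_functor_def by blast
qed

lemma presented_has_presentation: "has_tangle_presentation presented_cat p_hat p_check"
  unfolding has_tangle_presentation_def
proof (intro conjI exI[of _ "\<lambda>m n f. f"])
  show "is_functor presented_cat presented_cat id (\<lambda>m n f. f)"
    using category_presented by (simp add: is_functor_def)
qed (auto simp: Obj_presented bij_betw_def)

theorem mainTheorem1:
  fixes \<phi> :: "'m::lattice_ordered_additive_monoid \<Rightarrow> 'm"
  shows
    "(\<forall>n k. admissible n k \<longrightarrow>
        T_hat n k \<in> (obj_set n :: 'm pobj set) \<rightarrow> obj_set (n + 2) \<and>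
        T_check \<phi> n k \<in> obj_set (n + 2) \<rightarrow> obj_set n) \<and>
     (\<forall>n k. \<forall>X\<in>obj_set n. admissible n k \<and> admissible n (k + 1) \<longrightarrow>
        T_check \<phi> n (k + 1) (T_hat n k X) = X) \<and>
     (\<forall>n k. \<forall>X\<in>obj_set n. admissible n k \<and> admissible n (k - 1) \<longrightarrow>
        T_check \<phi> n (k - 1) (T_hat n k X) = X) \<and>
     (\<forall>n k l. \<forall>X\<in>(obj_set n :: 'm pobj set). l \<ge> k + 2 \<and>
        admissible (n + 2) l \<and> admissible n k \<and> admissible (n + 2) k \<and> admissible n (l - 2) \<longrightarrow>
        T_hat (n + 2) l (T_hat n k X) = T_hat (n + 2) k (T_hat n (l - 2) X)) \<and>
     (\<forall>n k l. \<forall>X\<in>obj_set (n + 2). l \<ge> k + 2 \<and>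
        admissible (n - 2) (l - 2) \<and> admissible n k \<and> admissible (n - 2) k \<and> admissible n l \<longrightarrow>
        T_check \<phi> (n - 2) (l - 2) (T_check \<phi> n k X) = T_check \<phi> (n - 2) k (T_check \<phi> n l X)) \<and>
     (\<forall>n k l. \<forall>X\<in>obj_set n. l \<ge> k + 2 \<and>
        admissible (n - 2) (l - 2) \<and> admissible (n - 2) k \<and> admissible n k \<and> admissible n l \<longrightarrow>
        T_hat (n - 2) (l - 2) (T_check \<phi> (n - 2) k X) = T_check \<phi> n k (T_hat n l X)) \<and>
     (\<forall>n k l. \<forall>X\<in>obj_set n. l \<ge> k + 2 \<and>
        admissible n l \<and> admissible n k \<and> admissible (n - 2) k \<and> admissible (n - 2) (l - 2) \<longrightarrow>
        T_check \<phi> n l (T_hat n k X) = T_hat (n - 2) k (T_check \<phi> (n - 2) (l - 2) X)) \<and>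
     defines_functor \<phi> presented_cat p_hat p_check \<and>
     (has_tangle_presentation PT_cat t_hat t_check \<longrightarrow>
        defines_functor \<phi> PT_cat t_hat t_check)"
proof (intro conjI allI ballI impI, goal_cases)
  case (1 n k) then show ?case using T_hat_in_obj_set by blast
next
  case (2 n k) then show ?case using T_check_in_obj_set by blast
next
  case (3 n k X) then show ?case using T_check_T_hat_cancel[of X n k "k + 1" \<phi>] by blast
next
  case (4 n k X) then show ?case using T_check_T_hat_cancel[of X n k "k - 1" \<phi>] by (simp add: admissible_def)
next
  case (5 n k l X) then show ?case using T_hat_commute by blast
next
  case (6 n k l X) then show ?case using T_check_commute by blast
next
  case (7 n k l X) then show ?case using T_check_left_of_T_hat by blast
next
  case (8 n k l X) then show ?case using T_check_right_of_T_hat by blast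
next
  case 9 show ?case by (rule presentation_defines_functor[OF presented_has_presentation])
next
  case 10 then show ?case by (rule presentation_defines_functor)
qed

end
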